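(* Let $n\ge 2$ and let $\sigma\in VB_n/\Gamma_2(VP_n)$. Let $\theta=\overline{\pi}_p(\sigma)^{-1}$ and let $c\in C_{S_n}(\theta)$. Consider a transversal $T_\theta$ of the action of $\sigma$ on the set of generators $\{\lambda_{i,j}\mid 1\le i\ne j\le n\}$ of $VP_n/\Gamma_2(VP_n)$, and $\tilde c\in VB_n/\Gamma_2(VP_n)$ such that $\overline{\pi}_p(\tilde c)^{-1}=c$ and $\tilde c\,\sigma\,\tilde c^{-1}=\prod_{1\le i\ne j\le n}\lambda_{i,j}^{c_{i,j}}\,\sigma$. Then the elements $\prod_{\lambda_{r,s}\in T_\theta}\lambda_{r,s}^{a_{r,s}}\,\sigma$ and $\prod_{\lambda_{r,s}\in T_\theta}\lambda_{r,s}^{b_{r,s}}\,\sigma$ (with $a_{r,s},b_{r,s}\in\mathbb{Z}$) are conjugate in $VB_n/\Gamma_2(VP_n)$ if and only if (i) $\sum_{\lambda_{i,j}\in\mathcal{O}_\theta(\lambda_{r,s})}c_{i,j}+a_{r,s}=b_{r,s}$, for $\lambda_{c^{-1}(r),c^{-1}(s)}\in\mathcal{O}_\theta(\lambda_{r,s})$, where $\lambda_{r,s}\in T_\theta$; (ii) $\sum_{\lambda_{i,j}\in\mathcal{O}_\theta(\lambda_{r,s})}c_{i,j}+a_{c^{-1}(r),c^{-1}(s)}=b_{r,s}$, for $\lambda_{c^{-1}(r),c^{-1}(s)}\notin\mathcal{O}_\theta(\lambda_{r,s})$, where $a_{c^{-1}(r),c^{-1}(s)}=\sum_{\lambda_{i,j}\in\mathcal{O}_\theta(\lambda_{c^{-1}(r),c^{-1}(s)})}a_{i,j}$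 and $\lambda_{r,s}\in T_\theta$.
   Context: Permutations are composed left to right: $\sigma\tau(x)=\tau(\sigma(x))$. $C_{S_n}(\theta)$ is the centralizer of $\theta$ in $S_n$. $\Gamma_2(H)=[H,H]$. $VB_n$ is the virtual braid group, with generators $\sigma_i,\rho_i$ ($1\le i\le n-1$) and relations: $\sigma_i\sigma_{i+1}\sigma_i=\sigma_{i+1}\sigma_i\sigma_{i+1}$, $\rho_i\rho_{i+1}\rho_i=\rho_{i+1}\rho_i\rho_{i+1}$, $\rho_i\rho_{i+1}\sigma_i=\sigma_{i+1}\rho_i\rho_{i+1}$ for $1\le i\le n-2$; $\rho_i^2=1$; and $\sigma_i\sigma_j=\sigma_j\sigma_i$, $\rho_i\rho_j=\rho_j\rho_i$, $\sigma_i\rho_j=\rho_j\sigma_i$ for $|i-j|\ge 2$. $VP_n$ is the kernel of $\pi_p\colon VB_n\to S_n$, $\sigma_i,\rho_i\mapsto(i,i+1)$, and $\overline{\pi}_p\colon VB_n/\Gamma_2(VP_n)\to S_n$ is the induced map. Put $\lambda_{i,i+1}=\rho_i\sigma_i^{-1}$, $\lambda_{i+1,i}=\sigma_i^{-1}\rho_i$, and for $j>i+1$, $\lambda_{i,j}=w\lambda_{i,i+1}w^{-1}$, $\lambda_{j,i}=w\lambda_{i+1,i}w^{-1}$ with $w=\rho_{j-1}\rho_{j-2}\cdots\rho_{i+1}$. It is known that $VP_n/\Gamma_2(VP_n)$ is free Abelian with basis the (classes of the) $\lambda_{i,j}$, $1\le i\neq j\le n$, and that for $\nu\in VB_n/\Gamma_2(VP_n)$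 with $\theta=\overline{\pi}_p(\nu)^{-1}$ one has $\nu\lambda_{i,j}\nu^{-1}=\lambda_{\theta(i),\theta(j)}$. The action of $\nu$ on the $\lambda_{i,j}$ is the conjugation action of $\langle\nu\rangle$, $\mathcal{O}_\theta(\lambda_{i,j})=\{\lambda_{\theta^k(i),\theta^k(j)}\mid k\in\mathbb{Z}\}$ is the orbit of $\lambda_{i,j}$, and a transversal is a set with exactly one representative of each orbit. The exponents $c_{i,j}$ are integers. In the sum defining $a_{c^{-1}(r),c^{-1}(s)}$, the exponents $a_{i,j}$ with $\lambda_{i,j}\notin T_\theta$ are taken to be $0$, so that it equals the exponent $a_{r_1,s_1}$ of the representative $\lambda_{r_1,s_1}\in T_\theta$ of the orbit of $\lambda_{c^{-1}(r),c^{-1}(s)}$.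
   Formalization: For a fixed c the "only if" is false (n=2, σ=1, c=id, λ_{1,2} and λ_{2,1} are conjugate by ρ_1); proved instead: (i),(ii) hold iff some g over c conjugates the elements, and they are conjugate iff (i),(ii) hold for some c in C(θ) with some lift and exponents. *)

theory Defs
  imports
    "HOL-Algebra.Generated_Groups"
    "HOL-Algebra.Group_Action"
    "HOL-Algebra.FiniteProduct"
    "HOL-Combinatorics.Permutations"
begin

section \<open>Groups given by generators and relations\<close>

text \<open>A letter \<open>(x, True)\<close> stands for the generator \<open>x\<close> and \<open>(x, False)\<close> for its formal
  inverse.  A relation is a pair of words \<open>(l, r)\<close>, read \<open>l = r\<close>.\<close>

type_synonym 'g word = "('g \<times> bool) list"

definition words :: "'g set \<Rightarrow> 'g word set" where
  "words S = lists (S \<times> UNIV)"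

inductive_set word_rel :: "'g set \<Rightarrow> ('g word \<times> 'g word) set \<Rightarrow> ('g word \<times> 'g word) set"
  for S :: "'g set" and R :: "('g word \<times> 'g word) set" where
  refl: "w \<in> words S \<Longrightarrow> (w, w) \<in> word_rel S R"
| sym: "(u, v) \<in> word_rel S R \<Longrightarrow> (v, u) \<in> word_rel S R"
| trans: "(u, v) \<in> word_rel S R \<Longrightarrow> (v, w) \<in> word_rel S R \<Longrightarrow> (u, w) \<in> word_rel S R"
| cancel: "u \<in> words S \<Longrightarrow> v \<in> words S \<Longrightarrow> x \<in> S \<Longrightarrow>
    (u @ [(x, b), (x, \<not> b)] @ v, u @ v) \<in> word_rel S R"
| relation: "u \<in> words S \<Longrightarrow> v \<in> words S \<Longrightarrow> (l, r) \<in> R \<Longrightarrow> l \<in> words S \<Longrightarrow> r \<in> words S \<Longrightarrow>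
    (u @ l @ v, u @ r @ v) \<in> word_rel S R"

definition presented_group ::
  "'g set \<Rightarrow> ('g word \<times> 'g word) set \<Rightarrow> 'g word set monoid" where
  "presented_group S R =
    \<lparr> carrier = words S // word_rel S R,
      monoid.mult = (\<lambda>X Y. word_rel S R `` {u @ v | u v. u \<in> X \<and> v \<in> Y}),
      one = word_rel S R `` {[]} \<rparr>"

definition word_eval :: "('a, 'm) monoid_scheme \<Rightarrow> ('g \<Rightarrow> 'a) \<Rightarrow> 'g word \<Rightarrow> 'a" where
  "word_eval G f w =
    foldr (\<lambda>(x, b) y. (if b then f x else inv\<^bsub>G\<^esub> (f x)) \<otimes>\<^bsub>G\<^esub> y) w \<one>\<^bsub>G\<^esub>"

lemma words_simps [simp]:
  "[] \<in> words S"
  "p # w \<in> words S \<longleftrightarrow> fst p \<in> S \<and> w \<in> words S"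
  "u @ v \<in> words S \<longleftrightarrow> u \<in> words S \<and> v \<in> words S"
  by (cases p; auto simp: words_def)+

lemma word_rel_words:
  "(u, v) \<in> word_rel S R \<Longrightarrow> u \<in> words S \<and> v \<in> words S"
  by (induction rule: word_rel.induct) auto

lemma equiv_word_rel: "equiv (words S) (word_rel S R)"
proof (rule equivI)
  show "word_rel S R \<subseteq> words S \<times> words S"
    using word_rel_words by fast
  show "refl_on (words S) (word_rel S R)"
    by (auto intro!: refl_onI word_rel.refl)
  show "Relation.sym (word_rel S R)" by (auto intro: symI word_rel.sym)
  show "Relation.trans (word_rel S R)" by (meson transI word_rel.trans)
qed

lemma word_rel_append_left:
  "(u, v) \<in> word_rel S R \<Longrightarrow> w \<in> words S \<Longrightarrow> (w @ u, w @ v) \<in> word_rel S R"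
proof (induction rule: word_rel.induct)
  case (cancel u v x b)
  then show ?case using word_rel.cancel[of "w @ u" S v x b R] by simp
next
  case (relation u v l r)
  then show ?case using word_rel.relation[of "w @ u" S v l r R] by simp
qed (auto intro: word_rel.refl word_rel.sym word_rel.trans)

lemma word_rel_append_right:
  "(u, v) \<in> word_rel S R \<Longrightarrow> w \<in> words S \<Longrightarrow> (u @ w, v @ w) \<in> word_rel S R"
proof (induction rule: word_rel.induct)
  case (cancel u v x b)
  then show ?case using word_rel.cancel[of u S "v @ w" x b R] by simp
next
  case (relation u v l r)
  then show ?case using word_rel.relation[of u S "v @ w" l r R] by simp
qed (auto intro: word_rel.refl word_rel.sym word_rel.trans)

lemma word_rel_append:
  "(u, u') \<in> word_rel S R \<Longrightarrow> (v, v') \<in> word_rel S R \<Longrightarrow> (u @ v, u' @ v') \<in> word_rel S R"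
  by (meson word_rel.trans word_rel_append_left word_rel_append_right word_rel_words)

lemma presented_mult:
  assumes "u \<in> words S" "v \<in> words S"
  shows "word_rel S R `` {u} \<otimes>\<^bsub>presented_group S R\<^esub> word_rel S R `` {v} = word_rel S R `` {u @ v}"
proof -
  have "word_rel S R `` {u' @ v' | u' v'. u' \<in> word_rel S R `` {u} \<and> v' \<in> word_rel S R `` {v}}
      = word_rel S R `` {u @ v}" (is "?L = ?R")
  proof
    show "?L \<subseteq> ?R"
      by (auto intro: word_rel.trans[OF word_rel_append])
    show "?R \<subseteq> ?L"
      using assms by (auto intro: word_rel.refl)
  qed
  then show ?thesis by (simp add: presented_group_def)
qed

lemma presented_carrierE:
  assumes "X \<in> carrier (presented_group S R)"
  obtains w where "w \<in> words S" "X = word_rel S R `` {w}"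
  using assms by (auto simp: presented_group_def elim: quotientE)

lemma presented_carrierI:
  "w \<in> words S \<Longrightarrow> word_rel S R `` {w} \<in> carrier (presented_group S R)"
  by (auto simp: presented_group_def intro: quotientI)

lemma presented_inverse_word:
  assumes "w \<in> words S"
  shows "\<exists>v \<in> words S. (v @ w, []) \<in> word_rel S R"
  using assms
proof (induction w)
  case Nil
  then show ?case by (auto intro!: bexI[of _ "[]"] word_rel.refl)
next
  case (Cons p w)
  obtain x b where p: "p = (x, b)" by fastforce
  obtain v where v: "v \<in> words S" "(v @ w, []) \<in> word_rel S R"
    using Cons by auto
  have "(v @ [(x, \<not> b), (x, \<not> \<not> b)] @ w, v @ w) \<in> word_rel S R"
    using Cons.prems v p by (intro word_rel.cancel) auto
  then have "((v @ [(x, \<not> b)]) @ (p # w), []) \<in> word_rel S R"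
    using v(2) p by (auto intro: word_rel.trans)
  then show ?case
    using Cons.prems v p by (intro bexI[of _ "v @ [(x, \<not> b)]"]) auto
qed

lemma group_presented_group: "group (presented_group S R)"
proof (rule groupI)
  let ?G = "presented_group S R"
  have one: "\<one>\<^bsub>?G\<^esub> = word_rel S R `` {[]}" by (simp add: presented_group_def)
  show "\<one>\<^bsub>?G\<^esub> \<in> carrier ?G" by (simp add: one presented_carrierI)
  fix X assume X: "X \<in> carrier ?G"
  then obtain u where u: "u \<in> words S" "X = word_rel S R `` {u}" by (rule presented_carrierE)
  show "\<one>\<^bsub>?G\<^esub> \<otimes>\<^bsub>?G\<^esub> X = X" by (simp add: one u presented_mult)
  obtain v where v: "v \<in> words S" "(v @ u, []) \<in> word_rel S R"
    using presented_inverse_word[OF u(1)] by blast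
  have "word_rel S R `` {v} \<otimes>\<^bsub>?G\<^esub> X = \<one>\<^bsub>?G\<^esub>"
    using equiv_class_eq[OF equiv_word_rel v(2)] by (simp add: one u v presented_mult)
  then show "\<exists>Y \<in> carrier ?G. Y \<otimes>\<^bsub>?G\<^esub> X = \<one>\<^bsub>?G\<^esub>" using v(1) presented_carrierI by blast
  fix Y assume "Y \<in> carrier ?G"
  then obtain v where v: "v \<in> words S" "Y = word_rel S R `` {v}" by (rule presented_carrierE)
  show "X \<otimes>\<^bsub>?G\<^esub> Y \<in> carrier ?G" by (simp add: u v presented_mult presented_carrierI)
  fix Z assume "Z \<in> carrier ?G"
  then obtain w where w: "w \<in> words S" "Z = word_rel S R `` {w}" by (rule presented_carrierE)
  show "X \<otimes>\<^bsub>?G\<^esub> Y \<otimes>\<^bsub>?G\<^esub> Z = X \<otimes>\<^bsub>?G\<^esub> (Y \<otimes>\<^bsub>?G\<^esub> Z)"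
    by (simp add: u v w presented_mult)
qed

lemma (in group) word_eval_closed:
  assumes "f ` S \<subseteq> carrier G" "w \<in> words S"
  shows "word_eval G f w \<in> carrier G"
  using assms(2)
proof (induction w)
  case (Cons p w)
  then show ?case using assms(1) by (cases p) (auto simp: word_eval_def)
qed (simp add: word_eval_def)

lemma (in group) word_eval_append:
  assumes "f ` S \<subseteq> carrier G" "u \<in> words S" "v \<in> words S"
  shows "word_eval G f (u @ v) = word_eval G f u \<otimes> word_eval G f v"
  using assms(2)
proof (induction u)
  case Nil
  then show ?case using word_eval_closed[OF assms(1,3)] by (simp add: word_eval_def)
next
  case (Cons p u)
  obtain x b where p: "p = (x, b)" by fastforce
  have "f x \<in> carrier G" "word_eval G f u \<in> carrier G" "word_eval G f v \<in> carrier G"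
    using Cons.prems p assms word_eval_closed[OF assms(1)] by auto
  moreover have "word_eval G f (u @ v) = word_eval G f u \<otimes> word_eval G f v"
    using Cons by simp
  ultimately show ?case by (simp add: p word_eval_def m_assoc)
qed

lemma (in group) word_eval_cong:
  assumes "f ` S \<subseteq> carrier G"
    and R: "\<forall>(l, r) \<in> R. word_eval G f l = word_eval G f r"
    and "(u, v) \<in> word_rel S R"
  shows "word_eval G f u = word_eval G f v"
  using assms(3)
proof (induction rule: word_rel.induct)
  case (cancel u v x b)
  have "f x \<in> carrier G" using cancel assms(1) by auto
  then have "word_eval G f [(x, b), (x, \<not> b)] = \<one>" by (simp add: word_eval_def)
  moreover have "word_eval G f (u @ [(x, b), (x, \<not> b)] @ v) =
      word_eval G f u \<otimes> (word_eval G f [(x, b), (x, \<not> b)] \<otimes> word_eval G f v)"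
    using cancel by (simp add: word_eval_append[OF assms(1)] del: append_Cons append_Nil)
  ultimately show ?case
    using cancel by (simp add: word_eval_append[OF assms(1)] word_eval_closed[OF assms(1)])
next
  case (relation u v l r)
  moreover have "word_eval G f l = word_eval G f r" using R relation by blast
  ultimately show ?case by (simp add: word_eval_append[OF assms(1)])
qed auto

lemma (in group) word_eval_class:
  assumes "f ` S \<subseteq> carrier G"
    and "\<forall>(l, r) \<in> R. word_eval G f l = word_eval G f r"
    and "w \<in> words S"
  shows "the_elem (word_eval G f ` (word_rel S R `` {w})) = word_eval G f w"
proof (rule the_elem_image_unique)
  show "word_rel S R `` {w} \<noteq> {}" using word_rel.refl[OF assms(3), of R] by blast
  fix v assume "v \<in> word_rel S R `` {w}"
  then have "(w, v) \<in> word_rel S R" by simp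
  then show "word_eval G f v = word_eval G f w"
    by (rule word_eval_cong[OF assms(1,2), symmetric])
qed

lemma (in group) word_eval_hom:
  assumes "f ` S \<subseteq> carrier G"
    and "\<forall>(l, r) \<in> R. word_eval G f l = word_eval G f r"
  shows "(\<lambda>X. the_elem (word_eval G f ` X)) \<in> hom (presented_group S R) G"
proof (rule homI)
  fix X assume "X \<in> carrier (presented_group S R)"
  then obtain u where u: "u \<in> words S" "X = word_rel S R `` {u}" by (rule presented_carrierE)
  show "the_elem (word_eval G f ` X) \<in> carrier G"
    using word_eval_class[OF assms u(1)] word_eval_closed[OF assms(1) u(1)] u(2) by simp
  fix Y assume "Y \<in> carrier (presented_group S R)"
  then obtain v where v: "v \<in> words S" "Y = word_rel S R `` {v}" by (rule presented_carrierE)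
  have "the_elem (word_eval G f ` (X \<otimes>\<^bsub>presented_group S R\<^esub> Y)) = word_eval G f (u @ v)"
    unfolding u(2) v(2) presented_mult[OF u(1) v(1)]
    by (rule word_eval_class[OF assms]) (use u v in auto)
  also have "\<dots> = word_eval G f u \<otimes> word_eval G f v"
    by (rule word_eval_append[OF assms(1) u(1) v(1)])
  also have "\<dots> = the_elem (word_eval G f ` X) \<otimes> the_elem (word_eval G f ` Y)"
    unfolding u(2) v(2) word_eval_class[OF assms u(1)] word_eval_class[OF assms v(1)] by (rule HOL.refl)
  finally show "the_elem (word_eval G f ` (X \<otimes>\<^bsub>presented_group S R\<^esub> Y)) =
    the_elem (word_eval G f ` X) \<otimes> the_elem (word_eval G f ` Y)" .
qed


section \<open>The symmetric group, composed left to right\<close>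

text \<open>\<open>sym_group\<close> of the library composes right to left; here \<open>(\<sigma>\<tau>)(x) = \<tau>(\<sigma>(x))\<close>.\<close>

definition sym_ltr :: "nat \<Rightarrow> (nat \<Rightarrow> nat) monoid" where
  "sym_ltr n = \<lparr> carrier = {p. p permutes {1..n}}, monoid.mult = (\<lambda>\<sigma> \<tau>. \<tau> \<circ> \<sigma>), one = id \<rparr>"

lemma group_sym_ltr: "group (sym_ltr n)"
  by (rule groupI)
    (auto simp: sym_ltr_def permutes_compose permutes_id comp_assoc
      intro: permutes_inv permutes_inv_o)

definition centralizer :: "('a, 'm) monoid_scheme \<Rightarrow> 'a \<Rightarrow> 'a set" where
  "centralizer G x = {g \<in> carrier G. g \<otimes>\<^bsub>G\<^esub> x = x \<otimes>\<^bsub>G\<^esub> g}"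

definition conjugate_in :: "('a, 'm) monoid_scheme \<Rightarrow> 'a \<Rightarrow> 'a \<Rightarrow> bool" where
  "conjugate_in G x y \<longleftrightarrow> (\<exists>g \<in> carrier G. g \<otimes>\<^bsub>G\<^esub> x \<otimes>\<^bsub>G\<^esub> inv\<^bsub>G\<^esub> g = y)"


section \<open>The virtual braid group\<close>

datatype vb_gen = Sig nat | Rho nat

definition vb_gens :: "nat \<Rightarrow> vb_gen set" where
  "vb_gens n = Sig ` {1..<n} \<union> Rho ` {1..<n}"

abbreviation sg :: "nat \<Rightarrow> vb_gen \<times> bool" where "sg i \<equiv> (Sig i, True)"
abbreviation rh :: "nat \<Rightarrow> vb_gen \<times> bool" where "rh i \<equiv> (Rho i, True)"

definition vb_relations :: "nat \<Rightarrow> (vb_gen word \<times> vb_gen word) set" where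
  "vb_relations n =
     {([sg i, sg (i+1), sg i], [sg (i+1), sg i, sg (i+1)]) | i. 1 \<le> i \<and> i + 2 \<le> n}
   \<union> {([rh i, rh (i+1), rh i], [rh (i+1), rh i, rh (i+1)]) | i. 1 \<le> i \<and> i + 2 \<le> n}
   \<union> {([rh i, rh (i+1), sg i], [sg (i+1), rh i, rh (i+1)]) | i. 1 \<le> i \<and> i + 2 \<le> n}
   \<union> {([rh i, rh i], []) | i. i \<in> {1..<n}}
   \<union> {([sg i, sg j], [sg j, sg i]) | i j. i \<in> {1..<n} \<and> j \<in> {1..<n} \<and> (i + 2 \<le> j \<or> j + 2 \<le> i)}
   \<union> {([rh i, rh j], [rh j, rh i]) | i j. i \<in> {1..<n} \<and> j \<in> {1..<n} \<and> (i + 2 \<le> j \<or> j + 2 \<le> i)}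
   \<union> {([sg i, rh j], [rh j, sg i]) | i j. i \<in> {1..<n} \<and> j \<in> {1..<n} \<and> (i + 2 \<le> j \<or> j + 2 \<le> i)}"

definition VB :: "nat \<Rightarrow> vb_gen word set monoid" where
  "VB n = presented_group (vb_gens n) (vb_relations n)"

definition vb_class :: "nat \<Rightarrow> vb_gen word \<Rightarrow> vb_gen word set" where
  "vb_class n w = word_rel (vb_gens n) (vb_relations n) `` {w}"

definition vb_sigma :: "nat \<Rightarrow> nat \<Rightarrow> vb_gen word set" where
  "vb_sigma n i = vb_class n [sg i]"

definition vb_rho :: "nat \<Rightarrow> nat \<Rightarrow> vb_gen word set" where
  "vb_rho n i = vb_class n [rh i]"

fun gen_perm :: "vb_gen \<Rightarrow> nat \<Rightarrow> nat" where
  "gen_perm (Sig i) = transpose i (i + 1)"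
| "gen_perm (Rho i) = transpose i (i + 1)"

definition pi_p :: "nat \<Rightarrow> vb_gen word set \<Rightarrow> nat \<Rightarrow> nat" where
  "pi_p n X = the_elem (word_eval (sym_ltr n) gen_perm ` X)"

definition VP :: "nat \<Rightarrow> vb_gen word set set" where
  "VP n = kernel (VB n) (sym_ltr n) (pi_p n)"

abbreviation Gamma2_VP :: "nat \<Rightarrow> vb_gen word set set" where
  "Gamma2_VP n \<equiv> derived (VB n) (VP n)"

definition VBq :: "nat \<Rightarrow> vb_gen word set set monoid" where
  "VBq n = VB n Mod Gamma2_VP n"

text \<open>\<open>VP\<^sub>n / \<Gamma>\<^sub>2(VP\<^sub>n)\<close> is kept as a group of its own, since \<open>finprod\<close> needs a commutative
  group.  Its elements are cosets of the same subgroup, so it is contained in \<open>VBq n\<close>.\<close>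

definition VPq :: "nat \<Rightarrow> vb_gen word set set monoid" where
  "VPq n = (VB n)\<lparr>carrier := VP n\<rparr> Mod Gamma2_VP n"

definition pi_bar :: "nat \<Rightarrow> vb_gen word set set \<Rightarrow> nat \<Rightarrow> nat" where
  "pi_bar n X = the_elem (pi_p n ` X)"

definition theta_of :: "nat \<Rightarrow> vb_gen word set set \<Rightarrow> nat \<Rightarrow> nat" where
  "theta_of n \<nu> = inv\<^bsub>sym_ltr n\<^esub> (pi_bar n \<nu>)"


section \<open>The generators of \<open>VP\<^sub>n / \<Gamma>\<^sub>2(VP\<^sub>n)\<close>\<close>

text \<open>The word \<open>\<rho>\<^bsub>j-1\<^esub> \<rho>\<^bsub>j-2\<^esub> \<cdots> \<rho>\<^bsub>i+1\<^esub>\<close>, which is empty for \<open>j = i + 1\<close>; hence the formula for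
  \<open>lam\<close> below also covers the adjacent case.\<close>

definition rho_word :: "nat \<Rightarrow> nat \<Rightarrow> nat \<Rightarrow> vb_gen word set" where
  "rho_word n i j = vb_class n (map rh (rev [i + 1..<j]))"

definition lam :: "nat \<Rightarrow> nat \<Rightarrow> nat \<Rightarrow> vb_gen word set" where
  "lam n i j =
    (if i < j
     then rho_word n i j \<otimes>\<^bsub>VB n\<^esub> (vb_rho n i \<otimes>\<^bsub>VB n\<^esub> inv\<^bsub>VB n\<^esub> vb_sigma n i)
            \<otimes>\<^bsub>VB n\<^esub> inv\<^bsub>VB n\<^esub> rho_word n i j
     else rho_word n j i \<otimes>\<^bsub>VB n\<^esub> (inv\<^bsub>VB n\<^esub> vb_sigma n j \<otimes>\<^bsub>VB n\<^esub> vb_rho n j)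
            \<otimes>\<^bsub>VB n\<^esub> inv\<^bsub>VB n\<^esub> rho_word n j i)"

definition lamq :: "nat \<Rightarrow> nat \<Rightarrow> nat \<Rightarrow> vb_gen word set set" where
  "lamq n i j = Gamma2_VP n #>\<^bsub>VB n\<^esub> lam n i j"

definition index_pairs :: "nat \<Rightarrow> (nat \<times> nat) set" where
  "index_pairs n = {(i, j). i \<in> {1..n} \<and> j \<in> {1..n} \<and> i \<noteq> j}"

definition lam_gens :: "nat \<Rightarrow> vb_gen word set set set" where
  "lam_gens n = {lamq n i j | i j. (i, j) \<in> index_pairs n}"

definition pairs_in :: "nat \<Rightarrow> vb_gen word set set set \<Rightarrow> (nat \<times> nat) set" where
  "pairs_in n A = {(i, j) \<in> index_pairs n. lamq n i j \<in> A}"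

definition lam_prod ::
  "nat \<Rightarrow> (nat \<times> nat) set \<Rightarrow> (nat \<Rightarrow> nat \<Rightarrow> int) \<Rightarrow> vb_gen word set set" where
  "lam_prod n I e = finprod (VPq n) (\<lambda>(i, j). lamq n i j [^]\<^bsub>VPq n\<^esub> e i j) I"

definition lam_orbit :: "nat \<Rightarrow> (nat \<Rightarrow> nat) \<Rightarrow> nat \<Rightarrow> nat \<Rightarrow> vb_gen word set set set" where
  "lam_orbit n \<theta> i j =
    {lamq n ((\<theta> [^]\<^bsub>sym_ltr n\<^esub> k) i) ((\<theta> [^]\<^bsub>sym_ltr n\<^esub> k) j) | k :: int. True}"

definition is_transversal ::
  "nat \<Rightarrow> vb_gen word set set \<Rightarrow> vb_gen word set set set \<Rightarrow> bool" where
  "is_transversal n \<nu> T \<longleftrightarrow> T \<subseteq> lam_gens n \<and>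
    (\<forall>Q \<in> orbits ((VBq n)\<lparr>carrier := generate (VBq n) {\<nu>}\<rparr>) (lam_gens n)
            (\<lambda>g x. g \<otimes>\<^bsub>VBq n\<^esub> x \<otimes>\<^bsub>VBq n\<^esub> inv\<^bsub>VBq n\<^esub> g).
      \<exists>!t. t \<in> T \<inter> Q)"


section \<open>The data and the two conditions of the theorem\<close>

definition centralizing_lift ::
  "nat \<Rightarrow> vb_gen word set set \<Rightarrow> (nat \<Rightarrow> nat) \<Rightarrow> vb_gen word set set
    \<Rightarrow> (nat \<Rightarrow> nat \<Rightarrow> int) \<Rightarrow> bool" where
  "centralizing_lift n \<sigma> c ct e \<longleftrightarrow>
     c \<in> centralizer (sym_ltr n) (theta_of n \<sigma>) \<and>
     ct \<in> carrier (VBq n) \<and> theta_of n ct = c \<and>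
     ct \<otimes>\<^bsub>VBq n\<^esub> \<sigma> \<otimes>\<^bsub>VBq n\<^esub> inv\<^bsub>VBq n\<^esub> ct = lam_prod n (index_pairs n) e \<otimes>\<^bsub>VBq n\<^esub> \<sigma>"

text \<open>In the second condition, the exponents \<open>a i j\<close> outside the transversal count as \<open>0\<close>.\<close>

definition orbit_sum_conditions ::
  "nat \<Rightarrow> (nat \<Rightarrow> nat) \<Rightarrow> vb_gen word set set set \<Rightarrow> (nat \<Rightarrow> nat) \<Rightarrow> (nat \<Rightarrow> nat \<Rightarrow> int)
    \<Rightarrow> (nat \<Rightarrow> nat \<Rightarrow> int) \<Rightarrow> (nat \<Rightarrow> nat \<Rightarrow> int) \<Rightarrow> bool" where
  "orbit_sum_conditions n \<theta> T c e a b \<longleftrightarrow>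
    (let d = inv\<^bsub>sym_ltr n\<^esub> c in
      (\<forall>(r, s) \<in> pairs_in n T. lamq n (d r) (d s) \<in> lam_orbit n \<theta> r s \<longrightarrow>
         (\<Sum>(i, j) \<in> pairs_in n (lam_orbit n \<theta> r s). e i j) + a r s = b r s) \<and>
      (\<forall>(r, s) \<in> pairs_in n T. lamq n (d r) (d s) \<notin> lam_orbit n \<theta> r s \<longrightarrow>
         (\<Sum>(i, j) \<in> pairs_in n (lam_orbit n \<theta> r s). e i j)
         + (\<Sum>(i, j) \<in> pairs_in n (lam_orbit n \<theta> (d r) (d s)).
              if lamq n i j \<in> T then a i j else 0) = b r s))"


section \<open>Well-definedness\<close>

lemma group_VB: "group (VB n)"
  unfolding VB_def by (rule group_presented_group)

lemma gen_perm_closed: "gen_perm ` vb_gens n \<subseteq> carrier (sym_ltr n)"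
  by (auto simp: vb_gens_def sym_ltr_def intro!: permutes_swap_id)

lemma vb_relations_perm:
  assumes "(u, v) \<in> vb_relations n"
  shows "word_eval (sym_ltr n) gen_perm u = word_eval (sym_ltr n) gen_perm v"
proof -
  have braid: "transpose i (Suc i) \<circ> transpose (Suc i) (Suc (Suc i)) \<circ> transpose i (Suc i)
      = transpose (Suc i) (Suc (Suc i)) \<circ> transpose i (Suc i) \<circ> transpose (Suc i) (Suc (Suc i))"
    for i :: nat
  proof
    fix x
    consider "x = i" | "x = Suc i" | "x = Suc (Suc i)" | "x \<noteq> i" "x \<noteq> Suc i" "x \<noteq> Suc (Suc i)"
      by blast
    then show "(transpose i (Suc i) \<circ> transpose (Suc i) (Suc (Suc i)) \<circ> transpose i (Suc i)) x
      = (transpose (Suc i) (Suc (Suc i)) \<circ> transpose i (Suc i) \<circ> transpose (Suc i) (Suc (Suc i))) x"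
      by cases (simp_all add: transpose_apply_other)
  qed
  have comm: "transpose i (Suc i) \<circ> transpose j (Suc j) = transpose j (Suc j) \<circ> transpose i (Suc i)"
    if "i + 2 \<le> j \<or> j + 2 \<le> i" for i j :: nat
  proof
    fix x
    consider "x = i" | "x = Suc i" | "x = j" | "x = Suc j"
      | "x \<noteq> i" "x \<noteq> Suc i" "x \<noteq> j" "x \<noteq> Suc j"
      by blast
    then show "(transpose i (Suc i) \<circ> transpose j (Suc j)) x
      = (transpose j (Suc j) \<circ> transpose i (Suc i)) x"
      using that by cases (auto simp: transpose_apply_other)
  qed
  show ?thesis
    using assms unfolding vb_relations_def
    by (elim UnE; clarsimp simp: word_eval_def sym_ltr_def comp_assoc braid[unfolded comp_assoc])
      (rule comm, force)+
qed

lemma vb_relations_perm':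
  "\<forall>(u, v) \<in> vb_relations n. word_eval (sym_ltr n) gen_perm u = word_eval (sym_ltr n) gen_perm v"
  using vb_relations_perm by blast

lemma pi_p_hom: "pi_p n \<in> hom (VB n) (sym_ltr n)"
proof -
  have "pi_p n = (\<lambda>X. the_elem (word_eval (sym_ltr n) gen_perm ` X))"
    by (simp add: fun_eq_iff pi_p_def)
  then show ?thesis
    using group.word_eval_hom[OF group_sym_ltr gen_perm_closed vb_relations_perm']
    by (simp add: VB_def)
qed

lemma pi_p_gens:
  assumes "i \<in> {1..<n}"
  shows "pi_p n (vb_sigma n i) = transpose i (i + 1)" "pi_p n (vb_rho n i) = transpose i (i + 1)"
proof -
  have "pi_p n (vb_class n [(g, True)]) = gen_perm g" if "g \<in> vb_gens n" for g
  proof -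
    have "pi_p n (vb_class n [(g, True)]) = word_eval (sym_ltr n) gen_perm [(g, True)]"
      unfolding pi_p_def vb_class_def
      using that by (intro group.word_eval_class[OF group_sym_ltr gen_perm_closed vb_relations_perm']) auto
    then show ?thesis by (simp add: word_eval_def sym_ltr_def)
  qed
  then show "pi_p n (vb_sigma n i) = transpose i (i + 1)"
    "pi_p n (vb_rho n i) = transpose i (i + 1)"
    using assms by (auto simp: vb_sigma_def vb_rho_def vb_gens_def)
qed

lemma group_hom_pi_p: "group_hom (VB n) (sym_ltr n) (pi_p n)"
  by (simp add: group_hom_def group_hom_axioms_def group_VB group_sym_ltr pi_p_hom)

lemma normal_VP: "VP n \<lhd> VB n"
  unfolding VP_def by (rule group_hom.normal_kernel[OF group_hom_pi_p])

lemma normal_Gamma2_VP: "Gamma2_VP n \<lhd> VB n"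
  using group.derived_is_normal[OF group_VB normal_VP] .

lemma Gamma2_VP_subset: "Gamma2_VP n \<subseteq> VP n"
  using group.derived_incl[OF group_VB order_refl] normal_imp_subgroup[OF normal_VP] .

lemma group_VBq: "group (VBq n)"
  unfolding VBq_def by (rule normal.factorgroup_is_group[OF normal_Gamma2_VP])

lemma pi_bar_coset:
  assumes "x \<in> carrier (VB n)"
  shows "pi_bar n (Gamma2_VP n #>\<^bsub>VB n\<^esub> x) = pi_p n x"
proof -
  interpret group_hom "VB n" "sym_ltr n" "pi_p n" by (rule group_hom_pi_p)
  have "pi_p n y = \<one>\<^bsub>sym_ltr n\<^esub>" "y \<in> carrier (VB n)" if "y \<in> Gamma2_VP n" for y
    using that Gamma2_VP_subset[of n] by (auto simp: VP_def kernel_def)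
  moreover have "\<one>\<^bsub>VB n\<^esub> \<in> Gamma2_VP n"
    by (rule subgroup.one_closed[OF normal_imp_subgroup[OF normal_Gamma2_VP]])
  ultimately have "pi_p n ` (Gamma2_VP n #>\<^bsub>VB n\<^esub> x) = {pi_p n x}"
    using assms by (fastforce simp: r_coset_def image_iff)
  then show ?thesis by (simp add: pi_bar_def)
qed

lemma pi_bar_hom: "pi_bar n \<in> hom (VBq n) (sym_ltr n)"
proof (rule homI)
  interpret group_hom "VB n" "sym_ltr n" "pi_p n" by (rule group_hom_pi_p)
  fix X assume "X \<in> carrier (VBq n)"
  then obtain x where x: "x \<in> carrier (VB n)" "X = Gamma2_VP n #>\<^bsub>VB n\<^esub> x"
    by (auto simp: VBq_def FactGroup_def RCOSETS_def)
  then show "pi_bar n X \<in> carrier (sym_ltr n)" by (simp add: pi_bar_coset)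
  fix Y assume "Y \<in> carrier (VBq n)"
  then obtain y where y: "y \<in> carrier (VB n)" "Y = Gamma2_VP n #>\<^bsub>VB n\<^esub> y"
    by (auto simp: VBq_def FactGroup_def RCOSETS_def)
  show "pi_bar n (X \<otimes>\<^bsub>VBq n\<^esub> Y) = pi_bar n X \<otimes>\<^bsub>sym_ltr n\<^esub> pi_bar n Y"
    using x y by (simp add: VBq_def normal.rcos_sum[OF normal_Gamma2_VP] pi_bar_coset)
qed

lemma comm_group_VPq: "comm_group (VPq n)"
  unfolding VPq_def
  by (rule group.derived_quot_of_subgroup_is_comm_group
        [OF group_VB normal_imp_subgroup[OF normal_VP]])

end

theory Submission
  imports Defs "HOL-Combinatorics.Orbits"
begin

text \<open>Write \<open>\<Lambda>(f)\<close> for the product of the \<open>\<lambda>\<^bsub>i,j\<^esub>\<close> with exponents \<open>f\<close>, a function on the pairs of distinct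
indices, and \<open>\<pi>\<close> for the permutation of \<open>\<sigma>\<close>, so that \<open>\<theta> = \<pi>\<inverse>\<close>.  An element \<open>\<nu>\<close> with permutation \<open>p\<close>
conjugates \<open>\<Lambda>(f)\<close> to \<open>\<Lambda>(f \<circ> (p \<times> p))\<close> (\<open>lamq_conj\<close>, \<open>conj_by_Lam\<close>).  The two given elements are
\<open>A = \<Lambda>(a')\<sigma>\<close> and \<open>B = \<Lambda>(b')\<sigma>\<close>, where \<open>a'\<close>, \<open>b'\<close> are \<open>a\<close>, \<open>b\<close> extended by zero outside the
transversal.

Let \<open>g\<close> have permutation \<open>d = c\<inverse>\<close>.  From \<open>g A g\<inverse> = \<Lambda>(a' \<circ> (d \<times> d)) g\<sigma>g\<inverse>\<close> one sees that
\<open>g A g\<inverse> = B\<close> holds exactly when \<open>g\<sigma>g\<inverse> = \<Lambda>(b' - a' \<circ> (d \<times> d))\<sigma>\<close>.  A fixed lift \<open>c\<^sub>0\<close> of \<open>c\<close> satisfies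
\<open>c\<^sub>0\<sigma>c\<^sub>0\<inverse> = \<Lambda>(e)\<sigma>\<close>, and passing from \<open>c\<^sub>0\<close> to \<open>\<Lambda>(x)c\<^sub>0\<close> changes \<open>e\<close> by the coboundary
\<open>x - x \<circ> (\<pi> \<times> \<pi>)\<close>.  Hence a conjugating element with permutation \<open>d\<close> exists if and only if
\<open>b' - a' \<circ> (d \<times> d) - e\<close> is a coboundary, and an integer function is a coboundary of a permutation
with finite orbits if and only if its sum over each orbit vanishes (\<open>coboundary_orbit_sum_zero\<close>,
\<open>coboundary_if_orbit_sums_zero\<close>).  Since \<open>a'\<close> and \<open>b'\<close> are supported on a transversal and \<open>d\<close>
permutes the orbits, these sums are the two stated conditions (\<open>orbit_sum_conditions_iff\<close>).
For the unrestricted conjugacy relation, a conjugating \<open>g\<close> is itself a lift of its own \<open>c\<close>.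

Two facts about \<open>VB\<^sub>n\<close> feed this argument.  The conjugation rule for the \<open>\<lambda>\<^bsub>i,j\<^esub>\<close> is checked on
generators: each \<open>\<rho>\<^sub>k\<close> permutes them already in \<open>VB\<^sub>n\<close> (\<open>vb_rho_conj_lam\<close>), and \<open>\<sigma>\<^sub>k\<close> differs from
\<open>\<rho>\<^sub>k\<close> by an element of the Abelian group \<open>VP\<^sub>n/\<Gamma>\<^sub>2(VP\<^sub>n)\<close>.  That exponents can be read off an element
follows from a homomorphism to the semidirect product of the integer functions on pairs with \<open>S\<^sub>n\<close>
(\<open>vbq_model\<close>), which sends \<open>\<Lambda>(f)\<close> to \<open>f\<close>.  It also
compares an arbitrary \<open>g\<close> with a lift \<open>c\<^sub>0\<close> that has the same permutation: the image of \<open>g c\<^sub>0\<inverse>\<close> provides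
the coboundary between their exponents (\<open>lift_exponents_cohomologous\<close>).\<close>

section \<open>Integer coboundaries on the orbits of a map\<close>

lemma coboundary_orbit_sum_zero:
  fixes x :: "'a \<Rightarrow> int"
  assumes "y \<in> Orbits.orbit f y"
  shows "(\<Sum>z\<in>Orbits.orbit f y. x z - x (f z)) = 0"
proof -
  let ?O = "Orbits.orbit f y"
  have fin: "finite ?O" by (rule finite_orbit[OF assms])
  have img: "f ` ?O = ?O"
    using orbit_inverse[OF assms, of f f] self_in_orbit_step[OF assms] by simp
  then have "inj_on f ?O" using fin by (simp add: eq_card_imp_inj_on)
  then have "sum x ?O = (\<Sum>z\<in>?O. x (f z))"
    using sum.reindex[of f ?O x] img by simp
  then show ?thesis by (simp add: sum_subtractf)
qed

text \<open>On each finite orbit, fix a representative and let \<open>x y\<close> be the sum of \<open>h\<close> along the forward path from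
\<open>y\<close> to the representative, the latter excluded.  Then \<open>x y - x (f y) = h y\<close> telescopes, except at
the representative itself, where the path closes up and the identity is the vanishing of the orbit sum.
One function \<open>x\<close> serves all orbits at once.\<close>

lemma coboundary_if_orbit_sums_zero:
  fixes h :: "'a \<Rightarrow> int"
  obtains x where "\<And>y. y \<in> Orbits.orbit f y \<Longrightarrow> (\<Sum>z\<in>Orbits.orbit f y. h z) = 0 \<Longrightarrow>
    x y - x (f y) = h y"
proof -
  define rep where "rep Q = (SOME r. r \<in> Q)" for Q :: "'a set"
  define x where "x y = (\<Sum>m<funpow_dist f y (rep (Orbits.orbit f y)). h ((f ^^ m) y))" for y
  have "x y - x (f y) = h y"
    if y: "y \<in> Orbits.orbit f y" and zero: "(\<Sum>z\<in>Orbits.orbit f y. h z) = 0" for y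
  proof -
    define r where "r = rep (Orbits.orbit f y)"
    have r: "r \<in> Orbits.orbit f y"
      using y unfolding r_def rep_def by (rule someI)
    have step: "Orbits.orbit f (f y) = Orbits.orbit f y" by (rule self_in_orbit_step[OF y])
    have xfy: "x (f y) = (\<Sum>m<funpow_dist f (f y) r. h ((f ^^ Suc m) y))"
      by (simp add: x_def step r_def funpow_swap1)
    have shift: "(\<Sum>m<Suc (funpow_dist f (f y) r). h ((f ^^ m) y)) = h y + x (f y)"
      unfolding xfy by (subst sum.lessThan_Suc_shift) simp
    show ?thesis
    proof (cases "y = r")
      case False
      then have "funpow_dist f y r = Suc (funpow_dist f (f y) r)"
        using r by (rule funpow_dist_step)
      then show ?thesis using shift by (simp add: x_def r_def[symmetric])
    next
      case True
      have "(\<Sum>z\<in>Orbits.orbit f y. h z) = (\<Sum>m<Suc (funpow_dist f (f y) y). h ((f ^^ m) y))"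
        unfolding orbit_conv_funpow_dist1[OF y] atLeast0LessThan
        using inj_on_funpow_dist1[OF y] by (simp only: sum.reindex atLeast0LessThan o_def)
      moreover have "x y = 0"
        using funpow_dist_0[OF True, of f] by (simp add: x_def r_def[symmetric])
      ultimately show ?thesis using zero shift True by simp
    qed
  qed
  then show thesis using that by blast
qed

section \<open>A family indexed by pairs under adjacent transpositions\<close>

text \<open>An action of the Coxeter generators of \<open>S\<^sub>n\<close> and a family \<open>L i j\<close>, \<open>i < j\<close>, obtained from the adjacent members
\<open>L i (i+1)\<close> by sliding the upper index upwards.  Knowing how the generators move the adjacent
members suffices: by induction on \<open>j\<close>, a generator is pushed past the last sliding step with
the far commutation or the braid relation.  Only the generator that exchanges \<open>i\<close> and \<open>j = i + 1\<close>
would leave the family, so it is excluded.  The family is stated over increasing pairs so that it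
covers both \<open>\<lambda>\<^bsub>i,j\<^esub>\<close> and \<open>\<lambda>\<^bsub>j,i\<^esub>\<close>.\<close>

lemma adjacent_transpositions_permute_pairs:
  fixes act :: "nat \<Rightarrow> 'a \<Rightarrow> 'a" and L :: "nat \<Rightarrow> nat \<Rightarrow> 'a"
  assumes L_closed: "\<And>i j. 1 \<le> i \<Longrightarrow> i < j \<Longrightarrow> j \<le> n \<Longrightarrow> L i j \<in> C"
    and act_closed: "\<And>k y. 1 \<le> k \<Longrightarrow> k < n \<Longrightarrow> y \<in> C \<Longrightarrow> act k y \<in> C"
    and invol: "\<And>k y. 1 \<le> k \<Longrightarrow> k < n \<Longrightarrow> y \<in> C \<Longrightarrow> act k (act k y) = y"
    and far: "\<And>k l y. 1 \<le> k \<Longrightarrow> k + 2 \<le> l \<Longrightarrow> l < n \<Longrightarrow> y \<in> C \<Longrightarrow>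
      act k (act l y) = act l (act k y)"
    and braid: "\<And>k y. 1 \<le> k \<Longrightarrow> k + 1 < n \<Longrightarrow> y \<in> C \<Longrightarrow>
      act k (act (k+1) (act k y)) = act (k+1) (act k (act (k+1) y))"
    and step: "\<And>i j. 1 \<le> i \<Longrightarrow> i < j \<Longrightarrow> j < n \<Longrightarrow> L i (j+1) = act j (L i j)"
    and base_far: "\<And>i k. 1 \<le> i \<Longrightarrow> i < n \<Longrightarrow> 1 \<le> k \<Longrightarrow> k < n \<Longrightarrow> k + 2 \<le> i \<or> i + 2 \<le> k \<Longrightarrow>
      act k (L i (i+1)) = L i (i+1)"
    and base_shift: "\<And>i. 1 \<le> i \<Longrightarrow> i + 2 \<le> n \<Longrightarrow> act i (act (i+1) (L i (i+1))) = L (i+1) (i+2)"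
    and ij: "1 \<le> i" "i < j" "j \<le> n" and k: "1 \<le> k" "k < n" and not_adj: "\<not> (i = k \<and> j = k + 1)"
  shows "act k (L i j) = L (transpose k (k+1) i) (transpose k (k+1) j)"
  using ij k not_adj
proof (induction j arbitrary: i k rule: less_induct)
  case (less j)
  show ?case
  proof (cases "j = i + 1")
    case True
    consider "k + 2 \<le> i \<or> i + 2 \<le> k" | "k = i + 1" | "i = k + 1"
      using less.prems True by linarith
    then show ?thesis
    proof cases
      case 1
      then show ?thesis using base_far[of i k] less.prems True by (auto simp: transpose_def)
    next
      case 2
      then show ?thesis using step[of i "i+1"] less.prems True by (auto simp: transpose_def)
    next
      case 3
      have "act k (act k (act (k+1) (L k (k+1)))) = act k (L (k+1) (k+2))"
        using base_shift[of k] less.prems 3 True by simp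
      moreover have "act k (act k (act (k+1) (L k (k+1)))) = act (k+1) (L k (k+1))"
        using less.prems 3 True by (intro invol act_closed L_closed) auto
      moreover have "L k (k+2) = act (k+1) (L k (k+1))"
        using step[of k "k+1"] less.prems 3 True by simp
      ultimately show ?thesis using 3 True by (simp add: transpose_def)
    qed
  next
    case False
    define m where "m = j - 1"
    have m: "j = m + 1" "i < m" "m < n" "1 \<le> m" using less.prems False by (auto simp: m_def)
    have Lj: "L i j = act m (L i m)" using step[of i m] less.prems m by simp
    have C: "L i m \<in> C" using less.prems m by (intro L_closed) auto
    consider "k = m" | "k = m + 1" | "m + 2 \<le> k" | "k + 2 \<le> m" | "k + 1 = m" by linarith
    then show ?thesis
    proof cases
      case 1
      then show ?thesis using Lj invol[OF _ _ C, of m] m by (simp add: transpose_def)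
    next
      case 2
      then show ?thesis using step[of i j] less.prems m by (simp add: transpose_def)
    next
      case 3
      have "act k (L i m) = L i m"
        using less.IH[of m i k] less.prems m 3 by (simp add: transpose_def)
      then show ?thesis using far[of m k "L i m"] 3 C Lj less.prems m by (simp add: transpose_def)
    next
      case 4
      have IH: "act k (L i m) = L (transpose k (k+1) i) m"
        using less.IH[of m i k] less.prems m 4 by (simp add: transpose_def)
      have "act m (L (transpose k (k+1) i) m) = L (transpose k (k+1) i) (m+1)"
        using less.prems m 4 by (intro step[symmetric]) (auto simp: transpose_def)
      then show ?thesis using far[of k m "L i m"] IH 4 C Lj less.prems m by (simp add: transpose_def)
    next
      case 5
      show ?thesis
      proof (cases "i = k")
        case True
        then show ?thesis using base_shift[of k] Lj 5 m less.prems by (auto simp: transpose_def)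
      next
        case False
        then have ik: "i < k" using 5 m by simp
        have C': "L i k \<in> C" using less.prems m ik 5 by (intro L_closed) auto
        have Lm: "L i m = act k (L i k)" using step[of i k] ik less.prems 5 by simp
        have fix_k: "act m (L i k) = L i k"
          using less.IH[of k i m] less.prems m ik 5 by (auto simp: transpose_def)
        have "act k (L i j) = act k (act (k+1) (act k (L i k)))" using Lj Lm 5 by simp
        also have "\<dots> = act (k+1) (act k (act (k+1) (L i k)))"
          using less.prems m 5 C' by (intro braid) auto
        also have "\<dots> = L i j" using fix_k Lj Lm 5 by simp
        finally show ?thesis using ik 5 m by (simp add: transpose_def)
      qed
    qed
  qed
qed

section \<open>Conjugation, and homomorphisms on generated groups\<close>

definition conj_by :: "('a, 'm) monoid_scheme \<Rightarrow> 'a \<Rightarrow> 'a \<Rightarrow> 'a" where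
  "conj_by G g x = g \<otimes>\<^bsub>G\<^esub> x \<otimes>\<^bsub>G\<^esub> inv\<^bsub>G\<^esub> g"

lemma (in group) conj_by_closed:
  "g \<in> carrier G \<Longrightarrow> x \<in> carrier G \<Longrightarrow> conj_by G g x \<in> carrier G"
  by (simp add: conj_by_def)

lemma (in group) conj_by_one:
  "x \<in> carrier G \<Longrightarrow> conj_by G \<one> x = x"
  by (simp add: conj_by_def)

lemma (in group) conj_by_conj_by:
  assumes "g \<in> carrier G" "h \<in> carrier G" "x \<in> carrier G"
  shows "conj_by G g (conj_by G h x) = conj_by G (g \<otimes> h) x"
  using assms by (simp add: conj_by_def m_assoc inv_mult_group)

lemma (in group) conj_by_mult:
  assumes "g \<in> carrier G" "x \<in> carrier G" "y \<in> carrier G"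
  shows "conj_by G g (x \<otimes> y) = conj_by G g x \<otimes> conj_by G g y"
proof -
  have "inv g \<otimes> (g \<otimes> (y \<otimes> inv g)) = y \<otimes> inv g"
    using assms by (simp add: m_assoc[symmetric])
  then show ?thesis using assms by (simp add: conj_by_def m_assoc)
qed

lemma (in group) conj_by_eq_iff:
  assumes "g \<in> carrier G" "x \<in> carrier G" "y \<in> carrier G"
  shows "conj_by G g x = y \<longleftrightarrow> g \<otimes> x = y \<otimes> g"
  using assms by (metis conj_by_def inv_solve_right m_closed)

lemma (in group) conj_by_hom:
  assumes "g \<in> carrier G"
  shows "group_hom G G (conj_by G g)"
  using assms by unfold_locales (auto intro!: homI simp: conj_by_closed conj_by_mult)

lemma (in group) conj_by_inv:
  assumes "g \<in> carrier G" "x \<in> carrier G"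
  shows "conj_by G g (inv x) = inv (conj_by G g x)"
  by (rule group_hom.hom_inv[OF conj_by_hom[OF assms(1)] assms(2)])

lemma (in group_hom) hom_conj_by:
  "g \<in> carrier G \<Longrightarrow> x \<in> carrier G \<Longrightarrow> h (conj_by G g x) = conj_by H (h g) (h x)"
  by (simp add: conj_by_def)

lemma hom_eq_on_generate:
  assumes "group_hom G H h" "group_hom G H k" "A \<subseteq> carrier G"
    and "\<And>x. x \<in> A \<Longrightarrow> h x = k x" and x: "x \<in> generate G A"
  shows "h x = k x"
  using x
proof (induction rule: generate.induct)
  case one
  then show ?case using assms(1,2) by (simp add: group_hom.hom_one)
next
  case (incl x)
  then show ?case by (rule assms(4))
next
  case (inv x)
  then have "x \<in> carrier G" using assms(3) by blast
  then show ?case using assms(1,2) inv by (simp add: group_hom.hom_inv assms(4))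
next
  case (eng x y)
  then have "x \<in> carrier G" "y \<in> carrier G"
    using group.generate_in_carrier[OF group_hom.axioms(1)[OF assms(1)] assms(3)] by auto
  then show ?case
    using eng assms(1,2)[THEN group_hom.homh] by (simp add: hom_mult)
qed

lemma presented_group_generated:
  "carrier (presented_group S R)
    = generate (presented_group S R) ((\<lambda>x. word_rel S R `` {[(x, True)]}) ` S)"
    (is "carrier ?G = generate ?G ?A")
proof
  interpret group ?G by (rule group_presented_group)
  let ?cl = "\<lambda>w. word_rel S R `` {w}"
  have A: "?A \<subseteq> carrier ?G" by (auto intro!: presented_carrierI)
  then show "generate ?G ?A \<subseteq> carrier ?G" by (rule generate_incl)
  have letter: "?cl [(x, b)] \<in> generate ?G ?A" if "x \<in> S" for x b
  proof (cases b)
    case True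
    then show ?thesis using that by (auto intro: generate.incl)
  next
    case False
    have "?cl [(x, False), (x, True)] = ?cl []"
      using word_rel.cancel[of "[]" S "[]" x False R] that
      by (intro equiv_class_eq[OF equiv_word_rel]) simp
    then have "?cl [(x, False)] \<otimes>\<^bsub>?G\<^esub> ?cl [(x, True)] = \<one>\<^bsub>?G\<^esub>"
      using that by (simp add: presented_mult) (simp add: presented_group_def)
    then have "?cl [(x, False)] = inv\<^bsub>?G\<^esub> ?cl [(x, True)]"
      using that by (intro inv_equality[symmetric] presented_carrierI) auto
    then show ?thesis using False that by (auto intro: generate.inv)
  qed
  have "?cl w \<in> generate ?G ?A" if "w \<in> words S" for w
    using that
  proof (induction w)
    case Nil
    then show ?case using generate.one[of ?G ?A] by (simp add: presented_group_def)
  next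
    case (Cons p w)
    then have "?cl (p # w) = ?cl [p] \<otimes>\<^bsub>?G\<^esub> ?cl w" by (simp add: presented_mult)
    then show ?case using Cons letter[of "fst p" "snd p"] by (auto intro: generate.eng)
  qed
  then show "carrier ?G \<subseteq> generate ?G ?A" by (auto elim: presented_carrierE)
qed

section \<open>Generators and relations of the virtual braid group\<close>

lemma VB_generated:
  "carrier (VB n) = generate (VB n) (vb_sigma n ` {1..<n} \<union> vb_rho n ` {1..<n})"
proof -
  have "(\<lambda>x. vb_class n [(x, True)]) ` vb_gens n = vb_sigma n ` {1..<n} \<union> vb_rho n ` {1..<n}"
    by (auto simp: vb_gens_def vb_sigma_def vb_rho_def image_iff)
  then show ?thesis
    using presented_group_generated[of "vb_gens n" "vb_relations n"]
    by (simp add: VB_def vb_class_def)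
qed

lemma vb_letters:
  "i \<in> {1..<n} \<Longrightarrow> Sig i \<in> vb_gens n" "i \<in> {1..<n} \<Longrightarrow> Rho i \<in> vb_gens n"
  by (auto simp: vb_gens_def)

lemma vb_class_closed: "w \<in> words (vb_gens n) \<Longrightarrow> vb_class n w \<in> carrier (VB n)"
  by (simp add: VB_def vb_class_def presented_carrierI)

lemma vb_sigma_closed: "i \<in> {1..<n} \<Longrightarrow> vb_sigma n i \<in> carrier (VB n)"
  by (simp add: vb_sigma_def vb_class_closed vb_letters)

lemma vb_rho_closed: "i \<in> {1..<n} \<Longrightarrow> vb_rho n i \<in> carrier (VB n)"
  by (simp add: vb_rho_def vb_class_closed vb_letters)

lemma vb_class_Nil: "vb_class n [] = \<one>\<^bsub>VB n\<^esub>"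
  by (simp add: VB_def vb_class_def presented_group_def)

lemma vb_class_append:
  "u \<in> words (vb_gens n) \<Longrightarrow> v \<in> words (vb_gens n) \<Longrightarrow>
    vb_class n (u @ v) = vb_class n u \<otimes>\<^bsub>VB n\<^esub> vb_class n v"
  by (simp add: VB_def vb_class_def presented_mult)

lemma vb_class_Cons:
  assumes "i \<in> {1..<n}" "w \<in> words (vb_gens n)"
  shows "vb_class n (sg i # w) = vb_sigma n i \<otimes>\<^bsub>VB n\<^esub> vb_class n w"
    and "vb_class n (rh i # w) = vb_rho n i \<otimes>\<^bsub>VB n\<^esub> vb_class n w"
  using vb_class_append[of "[sg i]" n w] vb_class_append[of "[rh i]" n w] assms
  by (simp_all add: vb_sigma_def vb_rho_def vb_letters)

lemma vb_class_relation:
  assumes "(l, r) \<in> vb_relations n" "l \<in> words (vb_gens n)" "r \<in> words (vb_gens n)"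
  shows "vb_class n l = vb_class n r"
  unfolding vb_class_def
  using word_rel.relation[of "[]" "vb_gens n" "[]" l r "vb_relations n"] assms
  by (intro equiv_class_eq[OF equiv_word_rel]) simp

lemmas vb_word_simps =
  vb_class_Cons vb_class_Nil vb_letters vb_sigma_closed vb_rho_closed

lemma vb_rho_square:
  assumes "i \<in> {1..<n}"
  shows "vb_rho n i \<otimes>\<^bsub>VB n\<^esub> vb_rho n i = \<one>\<^bsub>VB n\<^esub>"
proof -
  interpret group "VB n" by (rule group_VB)
  have "vb_class n [rh i, rh i] = vb_class n []"
    using assms by (intro vb_class_relation) (auto simp: vb_relations_def vb_gens_def)
  then show ?thesis using assms by (simp add: vb_word_simps del: atLeastLessThan_iff One_nat_def)
qed

lemma vb_rho_inv:
  assumes "i \<in> {1..<n}"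
  shows "inv\<^bsub>VB n\<^esub> vb_rho n i = vb_rho n i"
  by (rule group.inv_equality[OF group_VB vb_rho_square[OF assms] vb_rho_closed vb_rho_closed])
    (rule assms)+

lemma vb_braid:
  assumes "1 \<le> i" "i + 2 \<le> n"
  shows "vb_rho n i \<otimes>\<^bsub>VB n\<^esub> (vb_rho n (i+1) \<otimes>\<^bsub>VB n\<^esub> vb_rho n i)
      = vb_rho n (i+1) \<otimes>\<^bsub>VB n\<^esub> (vb_rho n i \<otimes>\<^bsub>VB n\<^esub> vb_rho n (i+1))"
    and "vb_rho n i \<otimes>\<^bsub>VB n\<^esub> (vb_rho n (i+1) \<otimes>\<^bsub>VB n\<^esub> vb_sigma n i)
      = vb_sigma n (i+1) \<otimes>\<^bsub>VB n\<^esub> (vb_rho n i \<otimes>\<^bsub>VB n\<^esub> vb_rho n (i+1))"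
proof -
  interpret group "VB n" by (rule group_VB)
  have i: "i \<in> {1..<n}" "i + 1 \<in> {1..<n}" using assms by auto
  have "vb_class n [rh i, rh (i+1), rh i] = vb_class n [rh (i+1), rh i, rh (i+1)]"
    using assms by (intro vb_class_relation) (auto simp: vb_relations_def vb_gens_def)
  then show "vb_rho n i \<otimes>\<^bsub>VB n\<^esub> (vb_rho n (i+1) \<otimes>\<^bsub>VB n\<^esub> vb_rho n i)
      = vb_rho n (i+1) \<otimes>\<^bsub>VB n\<^esub> (vb_rho n i \<otimes>\<^bsub>VB n\<^esub> vb_rho n (i+1))"
    using i by (simp add: vb_word_simps del: atLeastLessThan_iff One_nat_def add_Suc_right)
  have "vb_class n [rh i, rh (i+1), sg i] = vb_class n [sg (i+1), rh i, rh (i+1)]"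
    using assms by (intro vb_class_relation) (auto simp: vb_relations_def vb_gens_def)
  then show "vb_rho n i \<otimes>\<^bsub>VB n\<^esub> (vb_rho n (i+1) \<otimes>\<^bsub>VB n\<^esub> vb_sigma n i)
      = vb_sigma n (i+1) \<otimes>\<^bsub>VB n\<^esub> (vb_rho n i \<otimes>\<^bsub>VB n\<^esub> vb_rho n (i+1))"
    using i by (simp add: vb_word_simps del: atLeastLessThan_iff One_nat_def add_Suc_right)
qed

lemma vb_far_commute:
  assumes "i \<in> {1..<n}" "j \<in> {1..<n}" "i + 2 \<le> j \<or> j + 2 \<le> i"
  shows "vb_rho n i \<otimes>\<^bsub>VB n\<^esub> vb_rho n j = vb_rho n j \<otimes>\<^bsub>VB n\<^esub> vb_rho n i"
    and "vb_rho n j \<otimes>\<^bsub>VB n\<^esub> vb_sigma n i = vb_sigma n i \<otimes>\<^bsub>VB n\<^esub> vb_rho n j"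
proof -
  interpret group "VB n" by (rule group_VB)
  have "vb_class n [rh i, rh j] = vb_class n [rh j, rh i]"
    using assms by (intro vb_class_relation) (auto simp: vb_relations_def vb_gens_def)
  then show "vb_rho n i \<otimes>\<^bsub>VB n\<^esub> vb_rho n j = vb_rho n j \<otimes>\<^bsub>VB n\<^esub> vb_rho n i"
    using assms(1,2) by (simp add: vb_word_simps del: atLeastLessThan_iff One_nat_def)
  have "vb_class n [sg i, rh j] = vb_class n [rh j, sg i]"
    using assms by (intro vb_class_relation) (auto simp: vb_relations_def vb_gens_def)
  then show "vb_rho n j \<otimes>\<^bsub>VB n\<^esub> vb_sigma n i = vb_sigma n i \<otimes>\<^bsub>VB n\<^esub> vb_rho n j"
    using assms(1,2) by (simp add: vb_word_simps del: atLeastLessThan_iff One_nat_def)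
qed

section \<open>The action of the \<open>\<rho>\<^sub>k\<close> on the \<open>\<lambda>\<^bsub>i,j\<^esub>\<close>\<close>

lemma rho_word_adjacent: "rho_word n i (i+1) = \<one>\<^bsub>VB n\<^esub>"
  by (simp add: rho_word_def vb_class_Nil)

lemma rho_word_closed:
  assumes "1 \<le> i" "j \<le> n"
  shows "rho_word n i j \<in> carrier (VB n)"
proof -
  have "map rh (rev [i+1..<j]) \<in> words (vb_gens n)"
    using assms by (auto simp: words_def vb_gens_def)
  then show ?thesis by (simp add: rho_word_def vb_class_closed)
qed

lemma rho_word_Suc:
  assumes "1 \<le> i" "i < j" "j < n"
  shows "rho_word n i (j+1) = vb_rho n j \<otimes>\<^bsub>VB n\<^esub> rho_word n i j"
proof -
  have "map rh (rev [i+1..<j]) \<in> words (vb_gens n)"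
    using assms by (auto simp: words_def vb_gens_def)
  then show ?thesis using vb_class_Cons(2)[of j n "map rh (rev [i+1..<j])"] assms
    by (simp add: rho_word_def)
qed

lemma lam_eq_conj_by:
  assumes "i < j"
  shows "lam n i j = conj_by (VB n) (rho_word n i j) (vb_rho n i \<otimes>\<^bsub>VB n\<^esub> inv\<^bsub>VB n\<^esub> vb_sigma n i)"
    and "lam n j i = conj_by (VB n) (rho_word n i j) (inv\<^bsub>VB n\<^esub> vb_sigma n i \<otimes>\<^bsub>VB n\<^esub> vb_rho n i)"
  using assms by (simp_all add: lam_def conj_by_def)

lemma lam_adjacent:
  assumes "i \<in> {1..<n}"
  shows "lam n i (i+1) = vb_rho n i \<otimes>\<^bsub>VB n\<^esub> inv\<^bsub>VB n\<^esub> vb_sigma n i"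
    and "lam n (i+1) i = inv\<^bsub>VB n\<^esub> vb_sigma n i \<otimes>\<^bsub>VB n\<^esub> vb_rho n i"
proof -
  interpret group "VB n" by (rule group_VB)
  have "rho_word n i (i+1) = \<one>\<^bsub>VB n\<^esub>" by (rule rho_word_adjacent)
  then show "lam n i (i+1) = vb_rho n i \<otimes>\<^bsub>VB n\<^esub> inv\<^bsub>VB n\<^esub> vb_sigma n i"
    "lam n (i+1) i = inv\<^bsub>VB n\<^esub> vb_sigma n i \<otimes>\<^bsub>VB n\<^esub> vb_rho n i"
    using vb_rho_closed[OF assms] vb_sigma_closed[OF assms]
    by (simp_all add: lam_eq_conj_by conj_by_one)
qed

lemma lam_closed:
  assumes "(i, j) \<in> index_pairs n"
  shows "lam n i j \<in> carrier (VB n)"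
proof -
  interpret group "VB n" by (rule group_VB)
  have *: "lam n i j \<in> carrier (VB n) \<and> lam n j i \<in> carrier (VB n)"
    if "1 \<le> i" "i < j" "j \<le> n" for i j
  proof -
    have "i \<in> {1..<n}" using that by auto
    then show ?thesis
      using that by (simp add: lam_eq_conj_by conj_by_closed rho_word_closed
          vb_rho_closed vb_sigma_closed)
  qed
  show ?thesis using assms *[of i j] *[of j i] by (cases "i < j") (auto simp: index_pairs_def)
qed

text \<open>The recursive description of the \<open>\<lambda>\<^bsub>i,j\<^esub>\<close>, in the form of the sliding step above.\<close>

lemma lam_Suc:
  assumes "1 \<le> i" "i < j" "j < n"
  shows "lam n i (j+1) = conj_by (VB n) (vb_rho n j) (lam n i j)"
    and "lam n (j+1) i = conj_by (VB n) (vb_rho n j) (lam n j i)"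
proof -
  interpret group "VB n" by (rule group_VB)
  have "i \<in> {1..<n}" "j \<in> {1..<n}" using assms by auto
  note c = this[THEN vb_rho_closed] this[THEN vb_sigma_closed] rho_word_closed[of i j n]
  show "lam n i (j+1) = conj_by (VB n) (vb_rho n j) (lam n i j)"
    "lam n (j+1) i = conj_by (VB n) (vb_rho n j) (lam n j i)"
    using assms c by (simp_all add: lam_eq_conj_by rho_word_Suc[simplified] conj_by_conj_by)
qed

lemma vb_rho_conj_adjacent:
  assumes i: "i \<in> {1..<n}"
  defines "P \<equiv> vb_rho n i \<otimes>\<^bsub>VB n\<^esub> inv\<^bsub>VB n\<^esub> vb_sigma n i"
    and "M \<equiv> inv\<^bsub>VB n\<^esub> vb_sigma n i \<otimes>\<^bsub>VB n\<^esub> vb_rho n i"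
  shows "conj_by (VB n) (vb_rho n i) P = M" "conj_by (VB n) (vb_rho n i) M = P"
proof -
  interpret group "VB n" by (rule group_VB)
  note c = vb_rho_closed[OF i] vb_sigma_closed[OF i]
  show "conj_by (VB n) (vb_rho n i) P = M"
    unfolding conj_by_def vb_rho_inv[OF i] P_def M_def
    using c vb_rho_square[OF i] by (simp add: m_assoc[symmetric])
  show "conj_by (VB n) (vb_rho n i) M = P"
    unfolding conj_by_def vb_rho_inv[OF i] P_def M_def
    using c vb_rho_square[OF i] by (simp add: m_assoc)
qed

text \<open>Conjugation by \<open>u = \<rho>\<^sub>i\<rho>\<^bsub>i+1\<^esub>\<close> sends \<open>\<rho>\<^sub>i\<close> to \<open>\<rho>\<^bsub>i+1\<^esub>\<close> by the braid relation, and \<open>\<sigma>\<^sub>i\<close> to \<open>\<sigma>\<^bsub>i+1\<^esub>\<close> by the mixed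
relation.  Hence it shifts every expression in \<open>\<rho>\<^sub>i\<close> and \<open>\<sigma>\<^sub>i\<close>, whichever of the two adjacent
forms the family starts from.\<close>

lemma vb_rho_conj_family:
  fixes L :: "nat \<Rightarrow> nat \<Rightarrow> vb_gen word set"
  assumes L_closed: "\<And>i j. 1 \<le> i \<Longrightarrow> i < j \<Longrightarrow> j \<le> n \<Longrightarrow> L i j \<in> carrier (VB n)"
    and step: "\<And>i j. 1 \<le> i \<Longrightarrow> i < j \<Longrightarrow> j < n \<Longrightarrow>
      L i (j+1) = conj_by (VB n) (vb_rho n j) (L i j)"
    and base: "(\<forall>i\<in>{1..<n}. L i (i+1) = vb_rho n i \<otimes>\<^bsub>VB n\<^esub> inv\<^bsub>VB n\<^esub> vb_sigma n i)
      \<or> (\<forall>i\<in>{1..<n}. L i (i+1) = inv\<^bsub>VB n\<^esub> vb_sigma n i \<otimes>\<^bsub>VB n\<^esub> vb_rho n i)"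
    and ij: "1 \<le> i" "i < j" "j \<le> n" and k: "1 \<le> k" "k < n" and not_adj: "\<not> (i = k \<and> j = k + 1)"
  shows "conj_by (VB n) (vb_rho n k) (L i j) = L (transpose k (k+1) i) (transpose k (k+1) j)"
proof (rule adjacent_transpositions_permute_pairs[where C = "carrier (VB n)" and n = n])
  interpret group "VB n" by (rule group_VB)
  note conj_hom = conj_by_mult conj_by_inv
  show "conj_by (VB n) (vb_rho n k) y \<in> carrier (VB n)"
    if "1 \<le> k" "k < n" "y \<in> carrier (VB n)" for k y
    using that by (simp add: conj_by_closed vb_rho_closed)
  show "conj_by (VB n) (vb_rho n k) (conj_by (VB n) (vb_rho n k) y) = y"
    if "1 \<le> k" "k < n" "y \<in> carrier (VB n)" for k y
    using that by (simp add: conj_by_conj_by vb_rho_closed vb_rho_square conj_by_one)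
  show "conj_by (VB n) (vb_rho n k) (conj_by (VB n) (vb_rho n l) y)
      = conj_by (VB n) (vb_rho n l) (conj_by (VB n) (vb_rho n k) y)"
    if "1 \<le> k" "k + 2 \<le> l" "l < n" "y \<in> carrier (VB n)" for k l y
    using that vb_far_commute(1)[of k n l] by (simp add: conj_by_conj_by vb_rho_closed)
  show "conj_by (VB n) (vb_rho n k) (conj_by (VB n) (vb_rho n (k+1)) (conj_by (VB n) (vb_rho n k) y))
      = conj_by (VB n) (vb_rho n (k+1)) (conj_by (VB n) (vb_rho n k) (conj_by (VB n) (vb_rho n (k+1)) y))"
    if "1 \<le> k" "k + 1 < n" "y \<in> carrier (VB n)" for k y
    using that vb_braid(1)[of k n] by (simp add: conj_by_conj_by vb_rho_closed)
  show "conj_by (VB n) (vb_rho n k) (L i (i+1)) = L i (i+1)"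
    if "1 \<le> i" "i < n" "1 \<le> k" "k < n" "k + 2 \<le> i \<or> i + 2 \<le> k" for i k
  proof -
    have ik: "i \<in> {1..<n}" "k \<in> {1..<n}" using that by auto
    note c = vb_rho_closed[OF ik(1)] vb_rho_closed[OF ik(2)] vb_sigma_closed[OF ik(1)]
    have "conj_by (VB n) (vb_rho n k) (vb_rho n i) = vb_rho n i"
      "conj_by (VB n) (vb_rho n k) (vb_sigma n i) = vb_sigma n i"
      using vb_far_commute[OF ik that(5)[unfolded disj_commute[of "k+2 \<le> i"]]] c
      by (simp_all add: conj_by_eq_iff)
    then show ?thesis using base ik(1) c by (auto simp: conj_hom simp del: add_Suc_right One_nat_def)
  qed
  show "conj_by (VB n) (vb_rho n i) (conj_by (VB n) (vb_rho n (i+1)) (L i (i+1))) = L (i+1) (i+2)"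
    if "1 \<le> i" "i + 2 \<le> n" for i
  proof -
    have i: "i \<in> {1..<n}" "i + 1 \<in> {1..<n}" using that by auto
    note c = i[THEN vb_rho_closed] i[THEN vb_sigma_closed]
    let ?u = "vb_rho n i \<otimes>\<^bsub>VB n\<^esub> vb_rho n (i+1)"
    have "conj_by (VB n) ?u (vb_rho n i) = vb_rho n (i+1)"
      "conj_by (VB n) ?u (vb_sigma n i) = vb_sigma n (i+1)"
      using vb_braid[OF that] c by (simp_all add: conj_by_eq_iff m_assoc del: add_Suc_right)
    then have "conj_by (VB n) ?u (L i (i+1)) = L (i+1) (i+1+1)"
      using base i c by (auto simp: conj_hom simp del: add_Suc_right One_nat_def)
    then show ?thesis using L_closed[of i "i+1"] that c by (simp add: conj_by_conj_by)
  qed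
qed (use assms in auto)

text \<open>The pairs \<open>(k, k+1)\<close> and \<open>(k+1, k)\<close>, which the sliding argument leaves out, are exchanged because
\<open>\<rho>\<^sub>k(\<rho>\<^sub>k\<sigma>\<^sub>k\<inverse>)\<rho>\<^sub>k = \<sigma>\<^sub>k\<inverse>\<rho>\<^sub>k\<close>.\<close>

lemma vb_rho_conj_lam:
  assumes ij: "(i, j) \<in> index_pairs n" and k: "k \<in> {1..<n}"
  shows "conj_by (VB n) (vb_rho n k) (lam n i j)
    = lam n (transpose k (k+1) i) (transpose k (k+1) j)"
proof -
  have up: "conj_by (VB n) (vb_rho n k) (lam n i j)
      = lam n (transpose k (k+1) i) (transpose k (k+1) j)"
    if "1 \<le> i" "i < j" "j \<le> n" "\<not> (i = k \<and> j = k + 1)" for i j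
    using that k lam_adjacent
    by (intro vb_rho_conj_family[of n "\<lambda>i j. lam n i j"])
      (auto simp: lam_Suc(1)[simplified] index_pairs_def intro!: lam_closed)
  have down: "conj_by (VB n) (vb_rho n k) (lam n j i)
      = lam n (transpose k (k+1) j) (transpose k (k+1) i)"
    if "1 \<le> i" "i < j" "j \<le> n" "\<not> (i = k \<and> j = k + 1)" for i j
    using that k lam_adjacent
    by (intro vb_rho_conj_family[of n "\<lambda>i j. lam n j i"])
      (auto simp: lam_Suc(2)[simplified] index_pairs_def intro!: lam_closed)
  consider "i = k" "j = k + 1" | "j = k" "i = k + 1"
    | "i < j" "\<not> (i = k \<and> j = k + 1)" | "j < i" "\<not> (j = k \<and> i = k + 1)"
    using ij by (auto simp: index_pairs_def) linarith
  then show ?thesis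
  proof cases
    case 1
    then show ?thesis
      by (simp add: lam_adjacent[OF k, simplified] vb_rho_conj_adjacent[OF k])
  next
    case 2
    then show ?thesis
      by (simp add: lam_adjacent[OF k, simplified] vb_rho_conj_adjacent[OF k])
  next
    case 3
    then show ?thesis using up ij by (auto simp: index_pairs_def)
  next
    case 4
    then show ?thesis using down ij by (auto simp: index_pairs_def)
  qed
qed

section \<open>A semidirect product that reads off exponents\<close>

text \<open>The semidirect product of the integer functions on pairs with \<open>S\<^sub>n\<close>, the permutations composed
left to right.  The element \<open>(f, p)\<close> stands for a product of \<open>\<lambda>\<^bsub>i,j\<^esub>\<close> with exponents \<open>f\<close>, followed by a lift of
\<open>p\<close>; the twist by \<open>p\<close> itself (not its inverse) comes from \<open>\<nu>\<lambda>\<^bsub>p(i),p(j)\<^esub>\<nu>\<inverse> = \<lambda>\<^bsub>i,j\<^esub>\<close> for \<open>\<nu>\<close> over \<open>p\<close>.  Functions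
are total on pairs of naturals, which avoids support conditions.\<close>

definition model :: "nat \<Rightarrow> ((nat \<times> nat \<Rightarrow> int) \<times> (nat \<Rightarrow> nat)) monoid" where
  "model n = \<lparr> carrier = UNIV \<times> {p. p permutes {1..n}},
    monoid.mult = (\<lambda>(f, p) (g, q). (\<lambda>x. f x + g (map_prod p p x), q \<circ> p)),
    one = (\<lambda>_. 0, id) \<rparr>"

lemma model_simps:
  "(f, p) \<in> carrier (model n) \<longleftrightarrow> p permutes {1..n}"
  "(f, p) \<otimes>\<^bsub>model n\<^esub> (g, q) = (\<lambda>x. f x + g (map_prod p p x), q \<circ> p)"
  "\<one>\<^bsub>model n\<^esub> = (\<lambda>_. 0, id)"
  by (simp_all add: model_def)

lemma group_model: "group (model n)"
proof (rule groupI)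
  fix X assume "X \<in> carrier (model n)"
  then obtain f p where X: "X = (f, p)" "p permutes {1..n}" by (cases X) (auto simp: model_simps)
  show "\<one>\<^bsub>model n\<^esub> \<otimes>\<^bsub>model n\<^esub> X = X" by (simp add: X model_simps map_prod.id)
  have "(\<lambda>x. - f (map_prod (inv_into UNIV p) (inv_into UNIV p) x), inv_into UNIV p) \<otimes>\<^bsub>model n\<^esub> X = \<one>\<^bsub>model n\<^esub>"
    using permutes_inv_o(1)[OF X(2)]
    by (simp add: X model_simps fun_eq_iff split_paired_all)
  then show "\<exists>Y\<in>carrier (model n). Y \<otimes>\<^bsub>model n\<^esub> X = \<one>\<^bsub>model n\<^esub>"
    using permutes_inv[OF X(2)] by (metis model_simps(1))
qed (auto simp: model_def permutes_compose[unfolded o_def] permutes_id comp_assoc prod.map_comp o_def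
    split: prod.splits)

lemma model_snd_hom: "snd \<in> hom (model n) (sym_ltr n)"
  by (rule homI) (auto simp: model_def sym_ltr_def)

lemma snd_model_mult: "snd (X \<otimes>\<^bsub>model n\<^esub> Y) = snd Y \<circ> snd X"
  by (cases X; cases Y) (simp add: model_simps)

lemma model_int_pow: "(f, id) [^]\<^bsub>model n\<^esub> (k::int) = (\<lambda>x. k * f x, id)"
proof -
  interpret group "model n" by (rule group_model)
  have c: "(f, id) \<in> carrier (model n)" by (simp add: model_simps permutes_id)
  have nat: "(f, id) [^]\<^bsub>model n\<^esub> (m::nat) = (\<lambda>x. int m * f x, id)" for m
    by (induction m) (simp_all add: model_simps map_prod.id id_def o_def algebra_simps)
  show ?thesis
  proof (cases k rule: int_cases2)
    case (nonneg m)
    then show ?thesis by (simp add: int_pow_int nat)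
  next
    case (nonpos m)
    have "inv\<^bsub>model n\<^esub> (\<lambda>x. int m * f x, id) = (\<lambda>x. - (int m * f x), id)"
      by (intro inv_equality) (simp_all add: model_simps map_prod.id permutes_id)
    then show ?thesis using nonpos int_pow_neg_int[OF c, of m] by (simp add: nat)
  qed
qed

lemma sym_ltr_simps:
  "p \<in> carrier (sym_ltr n) \<longleftrightarrow> p permutes {1..n}"
  "p \<otimes>\<^bsub>sym_ltr n\<^esub> q = q \<circ> p"
  "\<one>\<^bsub>sym_ltr n\<^esub> = id"
  by (simp_all add: sym_ltr_def)

text \<open>Since \<open>\<lambda>\<^bsub>i,i+1\<^esub> = \<rho>\<^sub>i\<sigma>\<^sub>i\<inverse>\<close>, one has \<open>\<sigma>\<^sub>i = \<lambda>\<^bsub>i,i+1\<^esub>\<inverse>\<rho>\<^sub>i\<close>, which dictates the exponent \<open>-1\<close>.\<close>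

fun model_gen :: "vb_gen \<Rightarrow> (nat \<times> nat \<Rightarrow> int) \<times> (nat \<Rightarrow> nat)" where
  "model_gen (Sig i) = (\<lambda>x. if x = (i, i + 1) then -1 else 0, transpose i (i + 1))"
| "model_gen (Rho i) = (\<lambda>_. 0, transpose i (i + 1))"

lemma model_gen_closed: "model_gen ` vb_gens n \<subseteq> carrier (model n)"
  by (auto simp: vb_gens_def model_simps intro!: permutes_swap_id)

lemma snd_model_gen: "snd (model_gen g) = gen_perm g"
  by (cases g) auto

text \<open>Oriented so that the simplifier removes a transposition applied to a variable.\<close>

lemma transpose_eq_simps:
  "transpose a b c = a \<longleftrightarrow> c = b" "transpose a b c = b \<longleftrightarrow> c = a"
  "d \<noteq> a \<Longrightarrow> d \<noteq> b \<Longrightarrow> transpose a b c = d \<longleftrightarrow> c = d"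
  by (auto simp: transpose_def)

lemma vb_relations_model:
  "\<forall>(u, v) \<in> vb_relations n. word_eval (model n) model_gen u = word_eval (model n) model_gen v"
proof (intro ballI, clarify)
  fix u v assume uv: "(u, v) \<in> vb_relations n"
  have perm: "snd (word_eval (model n) model_gen w) = word_eval (sym_ltr n) gen_perm w"
    if "\<forall>(x, b) \<in> set w. b" for w
    using that
    by (induction w)
      (auto simp: word_eval_def snd_model_mult snd_model_gen sym_ltr_simps model_simps(3))
  have "\<forall>(x, b) \<in> set u. b" "\<forall>(x, b) \<in> set v. b"
    using uv by (auto simp: vb_relations_def)
  then have "snd (word_eval (model n) model_gen u) = snd (word_eval (model n) model_gen v)"
    using vb_relations_perm[OF uv] by (simp add: perm)
  moreover have "fst (word_eval (model n) model_gen u) = fst (word_eval (model n) model_gen v)"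
  proof (rule ext, clarify)
    fix k l
    show "fst (word_eval (model n) model_gen u) (k, l) = fst (word_eval (model n) model_gen v) (k, l)"
      using uv unfolding vb_relations_def
      by (elim UnE CollectE exE conjE disjE Pair_inject)
        (simp_all add: word_eval_def model_simps transpose_eq_simps)
  qed
  ultimately show "word_eval (model n) model_gen u = word_eval (model n) model_gen v"
    by (rule prod_eqI[rotated])
qed

text \<open>The homomorphism induced on classes of words; all words in a class have the same value.\<close>

definition vb_model :: "nat \<Rightarrow> vb_gen word set \<Rightarrow> (nat \<times> nat \<Rightarrow> int) \<times> (nat \<Rightarrow> nat)" where
  "vb_model n X = the_elem (word_eval (model n) model_gen ` X)"

lemma group_hom_vb_model: "group_hom (VB n) (model n) (vb_model n)"
proof -
  have "vb_model n = (\<lambda>X. the_elem (word_eval (model n) model_gen ` X))"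
    by (simp add: fun_eq_iff vb_model_def)
  then show ?thesis
    using group.word_eval_hom[OF group_model model_gen_closed vb_relations_model, of n]
    by (simp add: group_hom_def group_hom_axioms_def group_VB group_model VB_def
        group_presented_group)
qed

lemma vb_model_gens:
  assumes "i \<in> {1..<n}"
  shows "vb_model n (vb_sigma n i) = (\<lambda>x. if x = (i, i + 1) then -1 else 0, transpose i (i + 1))"
    and "vb_model n (vb_rho n i) = (\<lambda>_. 0, transpose i (i + 1))"
proof -
  have "vb_model n (vb_class n [(g, True)]) = model_gen g" if "g \<in> vb_gens n" for g
  proof -
    have "vb_model n (vb_class n [(g, True)]) = word_eval (model n) model_gen [(g, True)]"
      unfolding vb_model_def vb_class_def
      using that by (intro group.word_eval_class[OF group_model model_gen_closed vb_relations_model]) auto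
    then show ?thesis by (cases "model_gen g") (simp add: word_eval_def model_simps)
  qed
  then show "vb_model n (vb_sigma n i) = (\<lambda>x. if x = (i, i + 1) then -1 else 0, transpose i (i + 1))"
    "vb_model n (vb_rho n i) = (\<lambda>_. 0, transpose i (i + 1))"
    using assms by (auto simp: vb_sigma_def vb_rho_def vb_letters)
qed

lemma snd_vb_model:
  assumes "x \<in> carrier (VB n)"
  shows "snd (vb_model n x) = pi_p n x"
proof -
  have "group_hom (VB n) (sym_ltr n) (snd \<circ> vb_model n)"
    using hom_compose[OF group_hom.homh[OF group_hom_vb_model] model_snd_hom]
    by (simp add: group_hom_def group_hom_axioms_def group_VB group_sym_ltr)
  then have "(snd \<circ> vb_model n) x = pi_p n x"
  proof (rule hom_eq_on_generate[OF _ group_hom_pi_p])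
    show "vb_sigma n ` {1..<n} \<union> vb_rho n ` {1..<n} \<subseteq> carrier (VB n)"
      using vb_sigma_closed vb_rho_closed by blast
    show "(snd \<circ> vb_model n) y = pi_p n y" if "y \<in> vb_sigma n ` {1..<n} \<union> vb_rho n ` {1..<n}" for y
      using that vb_model_gens pi_p_gens by auto
    show "x \<in> generate (VB n) (vb_sigma n ` {1..<n} \<union> vb_rho n ` {1..<n})"
      using assms by (simp only: VB_generated)
  qed
  then show ?thesis by simp
qed

text \<open>Computed along the recursion for the \<open>\<lambda>\<^bsub>i,j\<^esub>\<close>: conjugation by \<open>\<rho>\<^sub>j\<close> moves the unit vector at one pair to
the unit vector at the transposed pair.\<close>

lemma vb_model_lam:
  assumes "(i, j) \<in> index_pairs n"
  shows "vb_model n (lam n i j) = (\<lambda>x. if x = (i, j) then 1 else 0, id)"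
proof -
  interpret group_hom "VB n" "model n" "vb_model n" by (rule group_hom_vb_model)
  let ?\<delta> = "\<lambda>i j. (\<lambda>x. if x = (i, j) then 1 else 0 :: int, id)"
  have "vb_model n (lam n i j) = ?\<delta> i j \<and> vb_model n (lam n j i) = ?\<delta> j i"
    if "1 \<le> i" "i < j" "j \<le> n" for i j
    using that
  proof (induction j)
    case (Suc j)
    show ?case
    proof (cases "i = j")
      case True
      then have i: "i \<in> {1..<n}" using Suc.prems by auto
      note c = vb_rho_closed[OF i] vb_sigma_closed[OF i]
      have inv: "inv\<^bsub>model n\<^esub> vb_model n (vb_sigma n i) =
          (\<lambda>x. if x = (i + 1, i) then 1 else 0, transpose i (i + 1))"
        using i c(2)[THEN hom_closed]
        by (intro H.inv_equality)
          (auto simp: vb_model_gens model_simps fun_eq_iff transpose_eq_simps intro!: permutes_swap_id)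
      have "vb_model n (lam n i (i+1)) = ?\<delta> i (i+1)" "vb_model n (lam n (i+1) i) = ?\<delta> (i+1) i"
        using c unfolding lam_adjacent[OF i]
        by (simp_all add: inv vb_model_gens(2)[OF i])
          (auto simp: model_simps fun_eq_iff transpose_eq_simps)
      then show ?thesis using True by (simp add: id_def)
    next
      case False
      then have IH: "vb_model n (lam n i j) = ?\<delta> i j" "vb_model n (lam n j i) = ?\<delta> j i"
        and ij: "1 \<le> i" "i < j" "j < n" and j: "j \<in> {1..<n}"
        using Suc by auto
      have c: "lam n i j \<in> carrier (VB n)" "lam n j i \<in> carrier (VB n)"
        using ij by (auto intro!: lam_closed simp: index_pairs_def)
      have invol: "inv\<^bsub>model n\<^esub> vb_model n (vb_rho n j) = vb_model n (vb_rho n j)"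
        using hom_inv[OF vb_rho_closed[OF j]] vb_rho_inv[OF j] by simp
      have model_conj: "conj_by (model n) (vb_model n (vb_rho n j)) (f, id)
          = (\<lambda>x. f (map_prod (transpose j (j+1)) (transpose j (j+1)) x), id)" for f
        unfolding conj_by_def invol by (simp add: vb_model_gens(2)[OF j] model_simps)
      have "vb_model n (lam n i (j+1)) = ?\<delta> i (j+1)" "vb_model n (lam n (j+1) i) = ?\<delta> (j+1) i"
        using ij c unfolding lam_Suc[OF ij]
        by (simp_all add: hom_conj_by vb_rho_closed[OF j] IH model_conj)
          (auto simp: fun_eq_iff transpose_eq_simps)
      then show ?thesis by (simp add: id_def)
    qed
  qed simp
  from this[of i j] this[of j i] show ?thesis
    using assms by (cases "i < j") (auto simp: index_pairs_def)
qed

section \<open>The quotient by \<open>\<Gamma>\<^sub>2(VP\<^sub>n)\<close>\<close>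

text \<open>Elements of \<open>VP\<^sub>n\<close> have trivial permutation, so their images lie in the Abelian normal factor of the
model, where commutators vanish.\<close>

lemma Gamma2_VP_in_kernel_vb_model: "Gamma2_VP n \<subseteq> kernel (VB n) (model n) (vb_model n)"
proof -
  interpret group_hom "VB n" "model n" "vb_model n" by (rule group_hom_vb_model)
  have "x \<otimes>\<^bsub>VB n\<^esub> y \<otimes>\<^bsub>VB n\<^esub> inv\<^bsub>VB n\<^esub> x \<otimes>\<^bsub>VB n\<^esub> inv\<^bsub>VB n\<^esub> y \<in> kernel (VB n) (model n) (vb_model n)"
    if xy: "x \<in> VP n" "y \<in> VP n" for x y
  proof -
    have c: "x \<in> carrier (VB n)" "y \<in> carrier (VB n)"
      and "pi_p n x = id" "pi_p n y = id"
      using xy by (auto simp: VP_def kernel_def sym_ltr_simps)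
    then have "snd (vb_model n x) = id" "snd (vb_model n y) = id"
      by (simp_all add: snd_vb_model)
    then have "vb_model n x \<otimes>\<^bsub>model n\<^esub> vb_model n y = vb_model n y \<otimes>\<^bsub>model n\<^esub> vb_model n x"
      by (cases "vb_model n x"; cases "vb_model n y") (simp add: model_simps map_prod.id add.commute)
    then have "vb_model n (x \<otimes>\<^bsub>VB n\<^esub> y) = vb_model n (y \<otimes>\<^bsub>VB n\<^esub> x)" using c by simp
    then have "vb_model n ((x \<otimes>\<^bsub>VB n\<^esub> y) \<otimes>\<^bsub>VB n\<^esub> inv\<^bsub>VB n\<^esub> (y \<otimes>\<^bsub>VB n\<^esub> x)) = \<one>\<^bsub>model n\<^esub>"
      using c by (simp del: hom_mult add: hom_mult[of "x \<otimes>\<^bsub>VB n\<^esub> y"])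
    then show ?thesis using c by (simp add: kernel_def G.inv_mult_group G.m_assoc)
  qed
  then show ?thesis
    unfolding derived_def by (intro G.generate_subgroup_incl subgroup_kernel) auto
qed

lemma group_hom_coset: "group_hom (VB n) (VBq n) (\<lambda>x. Gamma2_VP n #>\<^bsub>VB n\<^esub> x)"
  using normal.r_coset_hom_Mod[OF normal_Gamma2_VP, of n] group_VB group_VBq[of n]
  by (simp add: group_hom_def group_hom_axioms_def VBq_def)

lemma VBq_carrierE:
  assumes "X \<in> carrier (VBq n)"
  obtains x where "x \<in> carrier (VB n)" "X = Gamma2_VP n #>\<^bsub>VB n\<^esub> x"
  using assms by (auto simp: VBq_def FactGroup_def RCOSETS_def)

lemma group_hom_pi_bar: "group_hom (VBq n) (sym_ltr n) (pi_bar n)"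
  by (simp add: group_hom_def group_hom_axioms_def group_VBq group_sym_ltr pi_bar_hom)

lemma pi_bar_permutes: "X \<in> carrier (VBq n) \<Longrightarrow> pi_bar n X permutes {1..n}"
  using group_hom.hom_closed[OF group_hom_pi_bar] by (simp add: sym_ltr_simps)

lemma pi_bar_mult:
  "X \<in> carrier (VBq n) \<Longrightarrow> Y \<in> carrier (VBq n) \<Longrightarrow>
    pi_bar n (X \<otimes>\<^bsub>VBq n\<^esub> Y) = pi_bar n Y \<circ> pi_bar n X"
  using hom_mult[OF pi_bar_hom] by (simp add: sym_ltr_simps)

definition vbq_model :: "nat \<Rightarrow> vb_gen word set set \<Rightarrow> (nat \<times> nat \<Rightarrow> int) \<times> (nat \<Rightarrow> nat)" where
  "vbq_model n X = the_elem (vb_model n ` X)"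

lemma vbq_model_coset:
  assumes x: "x \<in> carrier (VB n)"
  shows "vbq_model n (Gamma2_VP n #>\<^bsub>VB n\<^esub> x) = vb_model n x"
proof -
  interpret group_hom "VB n" "model n" "vb_model n" by (rule group_hom_vb_model)
  have "x \<in> Gamma2_VP n #>\<^bsub>VB n\<^esub> x"
    by (rule G.rcos_self[OF x normal_imp_subgroup[OF normal_Gamma2_VP]])
  moreover have "vb_model n y = vb_model n x" if "y \<in> Gamma2_VP n #>\<^bsub>VB n\<^esub> x" for y
    using that x Gamma2_VP_in_kernel_vb_model[of n] by (auto simp: r_coset_def kernel_def)
  ultimately show ?thesis
    unfolding vbq_model_def by (blast intro: the_elem_image_unique)
qed

lemma group_hom_vbq_model: "group_hom (VBq n) (model n) (vbq_model n)"
proof -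
  interpret q: group_hom "VB n" "VBq n" "\<lambda>x. Gamma2_VP n #>\<^bsub>VB n\<^esub> x" by (rule group_hom_coset)
  interpret m: group_hom "VB n" "model n" "vb_model n" by (rule group_hom_vb_model)
  have "vbq_model n \<in> hom (VBq n) (model n)"
  proof (rule homI)
    fix X Y assume "X \<in> carrier (VBq n)"
    then obtain x where x: "x \<in> carrier (VB n)" "X = Gamma2_VP n #>\<^bsub>VB n\<^esub> x" by (rule VBq_carrierE)
    then show "vbq_model n X \<in> carrier (model n)" by (simp add: vbq_model_coset)
    assume "Y \<in> carrier (VBq n)"
    then obtain y where y: "y \<in> carrier (VB n)" "Y = Gamma2_VP n #>\<^bsub>VB n\<^esub> y" by (rule VBq_carrierE)
    show "vbq_model n (X \<otimes>\<^bsub>VBq n\<^esub> Y) = vbq_model n X \<otimes>\<^bsub>model n\<^esub> vbq_model n Y"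
      using x y by (simp del: q.hom_mult add: q.hom_mult[symmetric] vbq_model_coset)
  qed
  then show ?thesis by (simp add: group_hom_def group_hom_axioms_def group_VBq group_model)
qed

lemma snd_vbq_model:
  "X \<in> carrier (VBq n) \<Longrightarrow> snd (vbq_model n X) = pi_bar n X"
  by (elim VBq_carrierE) (simp add: vbq_model_coset pi_bar_coset snd_vb_model)

lemma carrier_VPq: "carrier (VPq n) = (\<lambda>x. Gamma2_VP n #>\<^bsub>VB n\<^esub> x) ` VP n"
  by (auto simp: VPq_def FactGroup_def RCOSETS_def r_coset_def)

lemma VPq_mult: "X \<otimes>\<^bsub>VPq n\<^esub> Y = X \<otimes>\<^bsub>VBq n\<^esub> Y"
  by (simp add: VPq_def VBq_def FactGroup_def set_mult_def)

lemma VPq_one: "\<one>\<^bsub>VPq n\<^esub> = \<one>\<^bsub>VBq n\<^esub>"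
  by (simp add: VPq_def VBq_def FactGroup_def)

lemma VP_iff: "x \<in> VP n \<longleftrightarrow> x \<in> carrier (VB n) \<and> pi_p n x = id"
  by (auto simp: VP_def kernel_def sym_ltr_simps)

lemma VPq_subset_VBq: "carrier (VPq n) \<subseteq> carrier (VBq n)"
  unfolding carrier_VPq
  using group_hom.hom_closed[OF group_hom_coset] by (auto simp: VP_iff)

lemma pi_bar_VPq: "X \<in> carrier (VPq n) \<Longrightarrow> pi_bar n X = id"
  unfolding carrier_VPq by (auto simp: VP_iff pi_bar_coset)

lemma lam_in_VP:
  assumes "(i, j) \<in> index_pairs n"
  shows "lam n i j \<in> VP n"
  using snd_vb_model[OF lam_closed[OF assms]] vb_model_lam[OF assms] lam_closed[OF assms]
  by (simp add: VP_iff)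

lemma lamq_in_VPq: "(i, j) \<in> index_pairs n \<Longrightarrow> lamq n i j \<in> carrier (VPq n)"
  by (simp add: lamq_def carrier_VPq lam_in_VP)

lemma vbq_model_lamq:
  "(i, j) \<in> index_pairs n \<Longrightarrow> vbq_model n (lamq n i j) = (\<lambda>x. if x = (i, j) then 1 else 0, id)"
  by (simp add: lamq_def vbq_model_coset lam_closed vb_model_lam)

text \<open>Distinct pairs give distinct unit vectors in the model.  This is what allows sums over sets of
generators to be rewritten as sums over sets of index pairs.\<close>

lemma lamq_inj:
  assumes "(i, j) \<in> index_pairs n" "(k, l) \<in> index_pairs n" "lamq n i j = lamq n k l"
  shows "(i, j) = (k, l)"
proof -
  have "(\<lambda>x. if x = (i, j) then 1 else 0 :: int) = (\<lambda>x. if x = (k, l) then 1 else 0)"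
    using vbq_model_lamq[OF assms(1)] vbq_model_lamq[OF assms(2)] unfolding assms(3)
    by (simp only: prod.inject)
  from fun_cong[OF this, of "(i, j)"] show ?thesis by (simp split: if_splits)
qed

lemma index_pairs_permutes:
  assumes "p permutes {1..n}"
  shows "(p i, p j) \<in> index_pairs n \<longleftrightarrow> (i, j) \<in> index_pairs n"
  using permutes_in_image[OF assms] permutes_inj[OF assms]
  by (auto simp: index_pairs_def inj_eq)

lemma conj_by_VPq:
  assumes "X \<in> carrier (VPq n)" "Y \<in> carrier (VPq n)"
  shows "conj_by (VBq n) X Y = Y"
proof -
  interpret group "VBq n" by (rule group_VBq)
  interpret VPq: comm_group "VPq n" by (rule comm_group_VPq)
  have "X \<in> carrier (VBq n)" "Y \<in> carrier (VBq n)" using assms VPq_subset_VBq by auto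
  then show ?thesis using VPq.m_comm[OF assms] by (simp only: conj_by_eq_iff VPq_mult)
qed

text \<open>The known conjugation rule \<open>\<nu>\<lambda>\<^bsub>i,j\<^esub>\<nu>\<inverse> = \<lambda>\<^bsub>\<theta>(i),\<theta>(j)\<^esub>\<close>, stated with \<open>\<theta>\<inverse>\<close> on the left-hand side so
that it composes along products without inverses.  For the generator \<open>\<sigma>\<^sub>k\<close> it follows from the case of \<open>\<rho>\<^sub>k\<close>, because
\<open>\<rho>\<^sub>k = \<lambda>\<^bsub>k,k+1\<^esub>\<sigma>\<^sub>k\<close> and \<open>\<lambda>\<^bsub>k,k+1\<^esub>\<close> acts trivially on \<open>VP\<^sub>n/\<Gamma>\<^sub>2(VP\<^sub>n)\<close>.\<close>

lemma lamq_conj: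
  assumes X: "X \<in> carrier (VBq n)" and ij: "(i, j) \<in> index_pairs n"
  shows "conj_by (VBq n) X (lamq n (pi_bar n X i) (pi_bar n X j)) = lamq n i j"
proof -
  interpret group "VBq n" by (rule group_VBq)
  interpret q: group_hom "VB n" "VBq n" "\<lambda>x. Gamma2_VP n #>\<^bsub>VB n\<^esub> x" by (rule group_hom_coset)
  interpret p: group_hom "VB n" "sym_ltr n" "pi_p n" by (rule group_hom_pi_p)
  let ?q = "\<lambda>x. Gamma2_VP n #>\<^bsub>VB n\<^esub> x" and ?A = "vb_sigma n ` {1..<n} \<union> vb_rho n ` {1..<n}"
  have A: "?A \<subseteq> carrier (VB n)" using vb_sigma_closed vb_rho_closed by blast
  have perm: "pi_p n x permutes {1..n}" if "x \<in> carrier (VB n)" for x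
    using p.hom_closed[OF that] by (simp add: sym_ltr_simps)
  have lamq_closed: "lamq n i j \<in> carrier (VBq n)" if "(i, j) \<in> index_pairs n" for i j
    using lamq_in_VPq[OF that] VPq_subset_VBq by blast
  have rho: "conj_by (VBq n) (?q (vb_rho n k)) (lamq n (transpose k (k+1) i) (transpose k (k+1) j))
      = lamq n i j" if k: "k \<in> {1..<n}" and ij: "(i, j) \<in> index_pairs n" for k i j
  proof -
    have s: "transpose k (k+1) permutes {1..n}" using k by (intro permutes_swap_id) auto
    then have ij': "(transpose k (k+1) i, transpose k (k+1) j) \<in> index_pairs n"
      using ij by (simp only: index_pairs_permutes)
    show ?thesis
      unfolding lamq_def q.hom_conj_by[OF vb_rho_closed[OF k] lam_closed[OF ij'], symmetric]
        vb_rho_conj_lam[OF ij' k] by simp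
  qed
  let ?P = "\<lambda>x. \<forall>i j. (i, j) \<in> index_pairs n \<longrightarrow>
      conj_by (VBq n) (?q x) (lamq n (pi_p n x i) (pi_p n x j)) = lamq n i j"
  have gens: "?P x" if "x \<in> ?A" for x
  proof -
    from that consider k where "k \<in> {1..<n}" "x = vb_rho n k" | k where "k \<in> {1..<n}" "x = vb_sigma n k"
      by blast
    then show ?thesis
    proof cases
      case 1
      then show ?thesis using rho pi_p_gens(2) by simp
    next
      case (2 k)
      note c = vb_rho_closed[OF 2(1)] vb_sigma_closed[OF 2(1)]
      have kk: "(k, k + 1) \<in> index_pairs n" using 2 by (auto simp: index_pairs_def)
      have "vb_rho n k = lam n k (k+1) \<otimes>\<^bsub>VB n\<^esub> vb_sigma n k"
        using c lam_adjacent(1)[OF 2(1)] by (simp add: q.G.m_assoc)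
      then have rho_eq: "?q (vb_rho n k) = lamq n k (k+1) \<otimes>\<^bsub>VBq n\<^esub> ?q (vb_sigma n k)"
        using c lam_closed[OF kk] by (simp add: lamq_def)
      show ?thesis
      proof (intro allI impI)
        fix i j assume ij: "(i, j) \<in> index_pairs n"
        have "transpose k (k+1) permutes {1..n}" using 2 by (intro permutes_swap_id) auto
        then have ij': "(transpose k (k+1) i, transpose k (k+1) j) \<in> index_pairs n"
          using ij by (simp only: index_pairs_permutes)
        let ?y = "conj_by (VBq n) (?q (vb_sigma n k)) (lamq n (transpose k (k+1) i) (transpose k (k+1) j))"
        have y: "?y \<in> carrier (VBq n)" using c lamq_closed[OF ij'] by (simp add: conj_by_closed)
        have "conj_by (VBq n) (lamq n k (k+1)) ?y = lamq n i j"
          using rho[OF 2(1) ij] c lamq_closed[OF kk] lamq_closed[OF ij']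
          by (simp add: rho_eq conj_by_conj_by)
        then have "conj_by (VBq n) (lamq n k (k+1)) ?y = conj_by (VBq n) (lamq n k (k+1)) (lamq n i j)"
          using conj_by_VPq[OF lamq_in_VPq[OF kk] lamq_in_VPq[OF ij]] by simp
        then have "?y = lamq n i j"
          using y lamq_closed[OF kk] lamq_closed[OF ij] by (simp add: conj_by_def)
        then show "conj_by (VBq n) (?q x) (lamq n (pi_p n x i) (pi_p n x j)) = lamq n i j"
          using pi_p_gens(1)[OF 2(1)] 2(2) by simp
      qed
    qed
  qed
  have "?P x" if "x \<in> generate (VB n) ?A" for x
    using that
  proof (induction rule: generate.induct)
    case one
    then show ?case using lamq_closed by (simp add: sym_ltr_simps conj_by_one)
  next
    case (incl x)
    then show ?case by (rule gens)
  next
    case (inv x)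
    then have x: "x \<in> carrier (VB n)" using A by blast
    let ?p = "pi_p n (inv\<^bsub>VB n\<^esub> x)"
    have pp: "pi_p n x (?p k) = k" for k
    proof -
      have "pi_p n (inv\<^bsub>VB n\<^esub> x \<otimes>\<^bsub>VB n\<^esub> x) = pi_p n x \<circ> ?p"
        using x by (simp only: p.hom_mult q.G.inv_closed sym_ltr_simps(2))
      then show ?thesis using x by (simp add: sym_ltr_simps fun_eq_iff del: p.hom_inv)
    qed
    show ?case
    proof (intro allI impI)
      fix i j assume ij: "(i, j) \<in> index_pairs n"
      have p_ij: "(?p i, ?p j) \<in> index_pairs n"
        using ij x index_pairs_permutes[OF perm] by (simp del: p.hom_inv)
      then have "conj_by (VBq n) (?q x) (lamq n i j) = lamq n (?p i) (?p j)"
        using gens[OF inv] pp by metis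
      then have "conj_by (VBq n) (?q (inv\<^bsub>VB n\<^esub> x)) (lamq n (?p i) (?p j))
          = conj_by (VBq n) (?q (inv\<^bsub>VB n\<^esub> x)) (conj_by (VBq n) (?q x) (lamq n i j))" by simp
      also have "\<dots> = lamq n i j"
        using x lamq_closed[OF ij] by (simp add: conj_by_conj_by conj_by_one del: p.hom_inv)
      finally show "conj_by (VBq n) (?q (inv\<^bsub>VB n\<^esub> x)) (lamq n (?p i) (?p j)) = lamq n i j" .
    qed
  next
    case (eng x y)
    then have c: "x \<in> carrier (VB n)" "y \<in> carrier (VB n)"
      using q.G.generate_in_carrier[OF A] by auto
    show ?case
    proof (intro allI impI)
      fix i j assume ij: "(i, j) \<in> index_pairs n"
      then have x_ij: "(pi_p n x i, pi_p n x j) \<in> index_pairs n"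
        using index_pairs_permutes[OF perm[OF c(1)]] by simp
      then have yx_ij: "(pi_p n y (pi_p n x i), pi_p n y (pi_p n x j)) \<in> index_pairs n"
        using index_pairs_permutes[OF perm[OF c(2)]] by simp
      show "conj_by (VBq n) (?q (x \<otimes>\<^bsub>VB n\<^esub> y)) (lamq n (pi_p n (x \<otimes>\<^bsub>VB n\<^esub> y) i) (pi_p n (x \<otimes>\<^bsub>VB n\<^esub> y) j))
          = lamq n i j"
        using eng.IH ij x_ij yx_ij c
        by (simp add: sym_ltr_simps conj_by_conj_by[symmetric] lamq_closed)
    qed
  qed
  moreover obtain x where "x \<in> carrier (VB n)" "X = ?q x" using X by (rule VBq_carrierE)
  ultimately show ?thesis using ij by (simp add: VB_generated pi_bar_coset)
qed

section \<open>Products of the \<open>\<lambda>\<^bsub>i,j\<^esub>\<close>\<close>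

lemma finite_index_pairs: "finite (index_pairs n)"
  by (rule finite_subset[of _ "{1..n} \<times> {1..n}"]) (auto simp: index_pairs_def)

lemma group_hom_VPq_VBq: "group_hom (VPq n) (VBq n) (\<lambda>x. x)"
  using comm_group.axioms(2)[OF comm_group_VPq[of n]] group_VBq[of n] VPq_subset_VBq[of n]
  by (auto simp: group_hom_def group_hom_axioms_def comm_group_def VPq_mult intro!: homI)

lemma VPq_int_pow: "X \<in> carrier (VPq n) \<Longrightarrow> X [^]\<^bsub>VPq n\<^esub> (k::int) = X [^]\<^bsub>VBq n\<^esub> k"
  by (rule group_hom.hom_int_pow[OF group_hom_VPq_VBq])

lemma lamq_pow_closed:
  assumes "I \<subseteq> index_pairs n"
  shows "(\<lambda>(i, j). lamq n i j [^]\<^bsub>VPq n\<^esub> (e i j :: int)) \<in> I \<rightarrow> carrier (VPq n)"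
proof -
  interpret comm_group "VPq n" by (rule comm_group_VPq)
  show ?thesis using assms lamq_in_VPq by (auto intro!: int_pow_closed)
qed

lemma lam_prod_closed:
  "I \<subseteq> index_pairs n \<Longrightarrow> lam_prod n I e \<in> carrier (VPq n)"
  unfolding lam_prod_def
  by (intro comm_monoid.finprod_closed comm_group.axioms(1) comm_group_VPq lamq_pow_closed)

lemma lam_prod_empty: "lam_prod n {} e = \<one>\<^bsub>VBq n\<^esub>"
proof -
  interpret comm_group "VPq n" by (rule comm_group_VPq)
  show ?thesis by (simp add: lam_prod_def VPq_one)
qed

lemma lam_prod_insert:
  assumes "finite I" "(i, j) \<notin> I" "insert (i, j) I \<subseteq> index_pairs n"
  shows "lam_prod n (insert (i, j) I) e = lamq n i j [^]\<^bsub>VBq n\<^esub> e i j \<otimes>\<^bsub>VBq n\<^esub> lam_prod n I e"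
proof -
  interpret comm_group "VPq n" by (rule comm_group_VPq)
  have ij: "lamq n i j \<in> carrier (VPq n)" using assms by (intro lamq_in_VPq) auto
  show ?thesis
    unfolding lam_prod_def VPq_int_pow[OF ij, symmetric] VPq_mult[symmetric]
    using assms ij lamq_pow_closed[of I n e] by (subst finprod_insert) auto
qed

lemma vbq_model_lam_prod:
  assumes "I \<subseteq> index_pairs n"
  shows "vbq_model n (lam_prod n I e) = (\<lambda>x. if x \<in> I then case_prod e x else 0, id)"
proof -
  interpret group_hom "VBq n" "model n" "vbq_model n" by (rule group_hom_vbq_model)
  have "finite I" using assms finite_index_pairs finite_subset by blast
  then show ?thesis using assms
  proof (induction I)
    case empty
    then show ?case by (simp add: lam_prod_empty model_simps id_def)
  next
    case (insert x I)
    obtain i j where x: "x = (i, j)" by (cases x)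
    have c: "lamq n i j \<in> carrier (VBq n)" "lam_prod n I e \<in> carrier (VBq n)"
      using insert.prems lamq_in_VPq[of i j n] lam_prod_closed[of I n e] VPq_subset_VBq[of n]
      by (auto simp: x)
    have "vbq_model n (lamq n i j [^]\<^bsub>VBq n\<^esub> e i j) = (\<lambda>y. e i j * (if y = (i, j) then 1 else 0), id)"
      using insert.prems c hom_int_pow[of "lamq n i j" "e i j"]
      by (simp add: vbq_model_lamq x model_int_pow)
    then show ?case
      using insert c unfolding x
      by (subst lam_prod_insert) (auto simp: model_simps map_prod.id fun_eq_iff)
  qed
qed

text \<open>Exponents become functions on pairs, and always range over all pairs of distinct indices; products over
a subset are brought into this form by extending the exponents by zero.\<close>

abbreviation Lam :: "nat \<Rightarrow> (nat \<times> nat \<Rightarrow> int) \<Rightarrow> vb_gen word set set" where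
  "Lam n f \<equiv> lam_prod n (index_pairs n) (curry f)"

lemma Lam_in_VPq: "Lam n f \<in> carrier (VPq n)"
  by (simp add: lam_prod_closed)

lemma Lam_in_VBq: "Lam n f \<in> carrier (VBq n)"
  using Lam_in_VPq VPq_subset_VBq by blast

lemma lam_prod_eq_Lam:
  assumes "I \<subseteq> index_pairs n"
  shows "lam_prod n I e = Lam n (\<lambda>x. if x \<in> I then case_prod e x else 0)"
proof -
  interpret comm_group "VPq n" by (rule comm_group_VPq)
  show ?thesis
    unfolding lam_prod_def using assms
    by (intro finprod_mono_neutral_cong_left lamq_pow_closed[OF order_refl])
      (auto simp: finite_index_pairs)
qed

lemma Lam_cong: "(\<And>x. x \<in> index_pairs n \<Longrightarrow> f x = g x) \<Longrightarrow> Lam n f = Lam n g"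
proof -
  assume "\<And>x. x \<in> index_pairs n \<Longrightarrow> f x = g x"
  then have "(\<lambda>x. if x \<in> index_pairs n then case_prod (curry f) x else 0)
      = (\<lambda>x. if x \<in> index_pairs n then case_prod (curry g) x else 0)" by auto
  then show ?thesis
    using lam_prod_eq_Lam[of "index_pairs n" n "curry f"] lam_prod_eq_Lam[of "index_pairs n" n "curry g"]
    by simp
qed

lemma Lam_mult: "Lam n f \<otimes>\<^bsub>VBq n\<^esub> Lam n g = Lam n (\<lambda>x. f x + g x)"
proof -
  interpret comm_group "VPq n" by (rule comm_group_VPq)
  note c = lamq_pow_closed[of "index_pairs n" n, OF order_refl]
  show ?thesis
    unfolding lam_prod_def VPq_mult[symmetric]
    by (subst finprod_multf[OF c c, symmetric], rule finprod_cong')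
      (auto simp: int_pow_mult lamq_in_VPq)
qed

lemma Lam_zero: "Lam n (\<lambda>_. 0) = \<one>\<^bsub>VBq n\<^esub>"
  using lam_prod_eq_Lam[of "{}" n "\<lambda>_ _. 0"] by (simp add: lam_prod_empty)

lemma Lam_inv: "inv\<^bsub>VBq n\<^esub> Lam n f = Lam n (\<lambda>x. - f x)"
  by (intro group.inv_equality[OF group_VBq]) (simp_all add: Lam_mult Lam_zero Lam_in_VBq)

text \<open>The product over the image of a set \<open>I\<close> of pairs under \<open>p \<times> p\<close> is carried to the
product over \<open>I\<close>, factor by factor; the set of all pairs is its own image.\<close>

lemma conj_by_Lam:
  assumes X: "X \<in> carrier (VBq n)"
  shows "conj_by (VBq n) X (Lam n f) = Lam n (\<lambda>x. f (map_prod (pi_bar n X) (pi_bar n X) x))"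
proof -
  interpret group "VBq n" by (rule group_VBq)
  interpret c: group_hom "VBq n" "VBq n" "conj_by (VBq n) X" by (rule conj_by_hom[OF X])
  let ?p = "pi_bar n X"
  let ?P = "map_prod ?p ?p"
  have p: "?p permutes {1..n}" by (rule pi_bar_permutes[OF X])
  have inj: "inj ?P" using permutes_inj[OF p] by (simp add: prod.inj_map)
  have img: "?P ` index_pairs n = index_pairs n"
  proof
    show "?P ` index_pairs n \<subseteq> index_pairs n" using index_pairs_permutes[OF p] by auto
    then show "index_pairs n \<subseteq> ?P ` index_pairs n"
      using endo_inj_surj[OF finite_index_pairs, of ?P n] inj inj_on_subset by blast
  qed
  have "conj_by (VBq n) X (lam_prod n (?P ` I) (curry f)) = lam_prod n I (curry (\<lambda>x. f (?P x)))"
    if "I \<subseteq> index_pairs n" for I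
  proof -
    have "finite I" using that finite_index_pairs finite_subset by blast
    then show ?thesis using that
    proof (induction I)
      case empty
      then show ?case by (simp add: lam_prod_empty)
    next
      case (insert x I)
      obtain i j where x: "x = (i, j)" by (cases x)
      have ij: "(i, j) \<in> index_pairs n" "(?p i, ?p j) \<in> index_pairs n"
        using insert.prems index_pairs_permutes[OF p] by (auto simp: x)
      have I: "I \<subseteq> index_pairs n" "?P ` I \<subseteq> index_pairs n" using insert.prems img by auto
      have notin: "(?p i, ?p j) \<notin> ?P ` I"
        using insert.hyps(2) by (auto simp: x dest!: injD[OF permutes_inj[OF p]])
      note closed = lamq_in_VPq[OF ij(2), THEN subsetD[OF VPq_subset_VBq]]
        lam_prod_closed[OF I(2), THEN subsetD[OF VPq_subset_VBq]]
      have "conj_by (VBq n) X (lam_prod n (?P ` insert x I) (curry f))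
          = conj_by (VBq n) X (lamq n (?p i) (?p j) [^]\<^bsub>VBq n\<^esub> f (?p i, ?p j)
              \<otimes>\<^bsub>VBq n\<^esub> lam_prod n (?P ` I) (curry f))"
        using insert.hyps ij I notin by (simp add: x lam_prod_insert)
      also have "\<dots> = lamq n i j [^]\<^bsub>VBq n\<^esub> f (?p i, ?p j)
          \<otimes>\<^bsub>VBq n\<^esub> lam_prod n I (curry (\<lambda>x. f (?P x)))"
        using closed insert.IH[OF I(1)] lamq_conj[OF X ij(1)]
        by (simp add: c.hom_int_pow curry_def)
      also have "\<dots> = lam_prod n (insert x I) (curry (\<lambda>x. f (?P x)))"
        using insert by (simp add: x lam_prod_insert)
      finally show ?case .
    qed
  qed
  from this[OF order_refl] show ?thesis by (simp add: img)
qed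

lemma pi_bar_Lam: "pi_bar n (Lam n f) = id"
  by (rule pi_bar_VPq[OF Lam_in_VPq])

lemma vbq_model_Lam: "vbq_model n (Lam n f) = (\<lambda>x. if x \<in> index_pairs n then f x else 0, id)"
  by (auto simp: vbq_model_lam_prod)

section \<open>Orbits of index pairs and transversals\<close>

abbreviation on_pairs :: "(nat \<Rightarrow> nat) \<Rightarrow> nat \<times> nat \<Rightarrow> nat \<times> nat" where
  "on_pairs p \<equiv> map_prod p p"

lemma funpow_multiple_fixpoint: "(f ^^ m) x = x \<Longrightarrow> (f ^^ (k * m)) x = x"
  by (induction k) (simp_all add: funpow_add)

text \<open>The map \<open>p \<times> p\<close> can move infinitely many pairs of naturals, for instance those with one index above
\<open>n\<close>, so the results on permutations of finite support are applied to the two components of a pair.\<close>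

lemma self_in_pair_orbit:
  assumes p: "p permutes {1..n}"
  shows "x \<in> Orbits.orbit (on_pairs p) x"
proof -
  obtain i j where x: "x = (i, j)" by (cases x)
  have "permutation p" using p by (rule permutes_imp_permutation[OF finite_atLeastAtMost])
  then obtain k l where k: "k > 0" "(p ^^ k) i = i" and l: "l > 0" "(p ^^ l) j = j"
    using permutation_self by metis
  have "on_pairs p ^^ m = on_pairs (p ^^ m)" for m
    by (induction m) (auto simp: fun_eq_iff)
  then have "(on_pairs p ^^ (k * l)) x = x"
    using funpow_multiple_fixpoint[OF k(2), of l] funpow_multiple_fixpoint[OF l(2), of k]
    by (simp add: x mult.commute)
  then show ?thesis unfolding orbit_altdef using k l by (metis (mono_tags, lifting) mem_Collect_eq nat_0_less_mult_iff)
qed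

lemma pair_orbit_eq:
  assumes "p permutes {1..n}" "y \<in> Orbits.orbit (on_pairs p) x"
  shows "Orbits.orbit (on_pairs p) y = Orbits.orbit (on_pairs p) x"
  using self_in_pair_orbit[OF assms(1)] assms(2)
  by (meson Orbits.orbit_trans orbit_swap subsetI subset_antisym)

lemma pair_orbit_subset_index_pairs:
  assumes "p permutes {1..n}" "x \<in> index_pairs n"
  shows "Orbits.orbit (on_pairs p) x \<subseteq> index_pairs n"
proof
  have *: "on_pairs p z \<in> index_pairs n \<longleftrightarrow> z \<in> index_pairs n" for z
    by (cases z) (simp add: index_pairs_permutes[OF assms(1)])
  fix y assume "y \<in> Orbits.orbit (on_pairs p) x"
  then show "y \<in> index_pairs n" by induction (use assms(2) in \<open>simp_all add: *\<close>)
qed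

text \<open>The orbit of a pair under the integer powers of \<open>\<theta> = p\<inverse>\<close> is its orbit under the positive
powers of \<open>p \<times> p\<close>, because orbits are finite cycles.\<close>

lemma pair_orbit_int_powers:
  assumes p: "p permutes {1..n}"
  defines "\<theta> \<equiv> inv\<^bsub>sym_ltr n\<^esub> p"
  shows "{((\<theta> [^]\<^bsub>sym_ltr n\<^esub> k) i, (\<theta> [^]\<^bsub>sym_ltr n\<^esub> k) j) | k :: int. True}
    = Orbits.orbit (on_pairs p) (i, j)" (is "?S = ?O")
proof -
  interpret group "sym_ltr n" by (rule group_sym_ltr)
  have c: "p \<in> carrier (sym_ltr n)" "\<theta> \<in> carrier (sym_ltr n)"
    using p inv_closed[of p] by (simp_all add: \<theta>_def sym_ltr_simps(1))
  have \<theta>p: "\<theta> (p k) = k" for k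
    using r_inv[OF c(1)] by (simp add: \<theta>_def sym_ltr_simps fun_eq_iff)
  have pow_Suc: "\<theta> [^]\<^bsub>sym_ltr n\<^esub> (k + 1) = \<theta> \<circ> (\<theta> [^]\<^bsub>sym_ltr n\<^esub> k)" for k :: int
    using int_pow_mult[OF c(2), of k 1] c by (simp add: sym_ltr_simps)
  have pow_pred: "\<theta> [^]\<^bsub>sym_ltr n\<^esub> (k - 1) = p \<circ> (\<theta> [^]\<^bsub>sym_ltr n\<^esub> k)" for k :: int
  proof -
    have "\<theta> [^]\<^bsub>sym_ltr n\<^esub> (- 1 :: int) = p"
      using int_pow_neg[OF c(2), of 1] c by (simp add: \<theta>_def)
    then show ?thesis
      using int_pow_mult[OF c(2), of k "-1"] by (simp add: sym_ltr_simps)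
  qed
  have O_\<theta>: "(\<theta> k, \<theta> l) \<in> ?O" if "(k, l) \<in> ?O" for k l
    using that by cases (use self_in_pair_orbit[OF p] in \<open>auto simp: \<theta>p\<close>)
  have O_p: "(p k, p l) \<in> ?O" if "(k, l) \<in> ?O" for k l
    using Orbits.orbit.step[OF that] by simp
  have "((\<theta> [^]\<^bsub>sym_ltr n\<^esub> k) i, (\<theta> [^]\<^bsub>sym_ltr n\<^esub> k) j) \<in> ?O" for k :: int
  proof (induction k rule: int_induct[where k = 0])
    case base
    then show ?case using self_in_pair_orbit[OF p] by (simp add: sym_ltr_simps)
  next
    case (step1 k)
    then show ?case using O_\<theta> by (simp add: pow_Suc)
  next
    case (step2 k)
    then show ?case using O_p by (simp add: pow_pred)
  qed
  moreover have "x \<in> ?S" if "x \<in> ?O" for x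
    using that
  proof induction
    case base
    have "on_pairs p (i, j) = ((\<theta> [^]\<^bsub>sym_ltr n\<^esub> (0 - 1 :: int)) i, (\<theta> [^]\<^bsub>sym_ltr n\<^esub> (0 - 1 :: int)) j)"
      unfolding pow_pred by (simp add: sym_ltr_simps)
    then show ?case by blast
  next
    case (step y)
    then obtain k :: int where "y = ((\<theta> [^]\<^bsub>sym_ltr n\<^esub> k) i, (\<theta> [^]\<^bsub>sym_ltr n\<^esub> k) j)" by blast
    then have "on_pairs p y = ((\<theta> [^]\<^bsub>sym_ltr n\<^esub> (k - 1)) i, (\<theta> [^]\<^bsub>sym_ltr n\<^esub> (k - 1)) j)"
      by (simp add: pow_pred)
    then show ?case by blast
  qed
  ultimately show ?thesis by blast
qed

lemma lam_orbit_eq: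
  assumes "p permutes {1..n}"
  shows "lam_orbit n (inv\<^bsub>sym_ltr n\<^esub> p) i j
    = case_prod (lamq n) ` Orbits.orbit (on_pairs p) (i, j)"
  unfolding pair_orbit_int_powers[OF assms, symmetric] lam_orbit_def by auto

lemma lamq_in_lam_orbit_iff:
  assumes p: "p permutes {1..n}" and ij: "(i, j) \<in> index_pairs n" and kl: "(k, l) \<in> index_pairs n"
  shows "lamq n k l \<in> lam_orbit n (inv\<^bsub>sym_ltr n\<^esub> p) i j
    \<longleftrightarrow> (k, l) \<in> Orbits.orbit (on_pairs p) (i, j)"
  unfolding lam_orbit_eq[OF p]
  using pair_orbit_subset_index_pairs[OF p ij] lamq_inj[OF kl] by fastforce

lemma pairs_in_lam_orbit:
  assumes p: "p permutes {1..n}" and ij: "(i, j) \<in> index_pairs n"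
  shows "pairs_in n (lam_orbit n (inv\<^bsub>sym_ltr n\<^esub> p) i j) = Orbits.orbit (on_pairs p) (i, j)"
  using pair_orbit_subset_index_pairs[OF p ij] lamq_in_lam_orbit_iff[OF p ij]
  by (auto simp: pairs_in_def)

lemma theta_of_permutes: "X \<in> carrier (VBq n) \<Longrightarrow> theta_of n X permutes {1..n}"
  using group.inv_closed[OF group_sym_ltr, of "pi_bar n X" n] pi_bar_permutes[of X n]
  by (simp add: theta_of_def sym_ltr_simps)

lemma inv_theta_of: "X \<in> carrier (VBq n) \<Longrightarrow> inv\<^bsub>sym_ltr n\<^esub> theta_of n X = pi_bar n X"
  using pi_bar_permutes[of X n] by (simp add: theta_of_def sym_ltr_simps group.inv_inv[OF group_sym_ltr])

lemma theta_of_eq_iff: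
  assumes "X \<in> carrier (VBq n)" "Y \<in> carrier (VBq n)"
  shows "theta_of n X = theta_of n Y \<longleftrightarrow> pi_bar n X = pi_bar n Y"
  using assms inv_theta_of by (metis theta_of_def)

text \<open>The orbits that define a transversal, those of the conjugation action of \<open>\<langle>\<nu>\<rangle>\<close>, are the orbits
\<open>\<O>\<^sub>\<theta>\<close> given by powers of \<open>\<theta>\<close>.\<close>

lemma conjugation_orbit_lamq:
  assumes X: "X \<in> carrier (VBq n)" and ij: "(i, j) \<in> index_pairs n"
  shows "Group_Action.orbit ((VBq n)\<lparr>carrier := generate (VBq n) {X}\<rparr>)
      (\<lambda>g x. g \<otimes>\<^bsub>VBq n\<^esub> x \<otimes>\<^bsub>VBq n\<^esub> inv\<^bsub>VBq n\<^esub> g) (lamq n i j)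
    = lam_orbit n (theta_of n X) i j"
proof -
  interpret group "VBq n" by (rule group_VBq)
  interpret p: group_hom "VBq n" "sym_ltr n" "pi_bar n" by (rule group_hom_pi_bar)
  have "conj_by (VBq n) (X [^]\<^bsub>VBq n\<^esub> k) (lamq n i j)
      = lamq n ((theta_of n X [^]\<^bsub>sym_ltr n\<^esub> k) i) ((theta_of n X [^]\<^bsub>sym_ltr n\<^esub> k) j)" for k :: int
  proof -
    let ?t = "theta_of n X [^]\<^bsub>sym_ltr n\<^esub> k" and ?p = "pi_bar n (X [^]\<^bsub>VBq n\<^esub> k)"
    have t: "?t = inv\<^bsub>sym_ltr n\<^esub> ?p"
      using X by (simp add: theta_of_def p.hom_int_pow p.H.int_pow_inv)
    have perm: "?t permutes {1..n}"
      using p.H.int_pow_closed[of "theta_of n X" k] theta_of_permutes[OF X] by (simp add: sym_ltr_simps)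
    have "?t \<otimes>\<^bsub>sym_ltr n\<^esub> ?p = \<one>\<^bsub>sym_ltr n\<^esub>"
      using X unfolding t by (intro p.H.l_inv p.hom_closed) simp
    then have "?p (?t m) = m" for m by (simp add: sym_ltr_simps fun_eq_iff)
    then show ?thesis
      using lamq_conj[of "X [^]\<^bsub>VBq n\<^esub> k" n "?t i" "?t j"] X ij index_pairs_permutes[OF perm] by simp
  qed
  then show ?thesis
    using X by (auto simp: Group_Action.orbit_def lam_orbit_def generate_pow conj_by_def)
qed

lemma transversal_representative:
  assumes T: "is_transversal n X T" and X: "X \<in> carrier (VBq n)" and x: "x \<in> index_pairs n"
  shows "\<exists>!y. y \<in> pairs_in n T \<inter> Orbits.orbit (on_pairs (pi_bar n X)) x"
proof -
  obtain i j where ij: "x = (i, j)" by (cases x)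
  note p = pi_bar_permutes[OF X]
  note x' = x[unfolded ij]
  let ?O = "Orbits.orbit (on_pairs (pi_bar n X)) x"
  have Q: "lam_orbit n (theta_of n X) i j = case_prod (lamq n) ` ?O"
    using lam_orbit_eq[OF p] by (simp add: theta_of_def ij)
  have O: "?O \<subseteq> index_pairs n" by (rule pair_orbit_subset_index_pairs[OF p x])
  have "lamq n i j \<in> lam_gens n" using x' by (auto simp: lam_gens_def)
  then have "\<exists>!t. t \<in> T \<inter> lam_orbit n (theta_of n X) i j"
    using T conjugation_orbit_lamq[OF X x'] unfolding is_transversal_def orbits_def by fastforce
  then obtain t where t: "t \<in> T" "t \<in> case_prod (lamq n) ` ?O"
    and unique: "\<And>s. s \<in> T \<Longrightarrow> s \<in> case_prod (lamq n) ` ?O \<Longrightarrow> s = t"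
    unfolding Q by blast
  then obtain y where y: "y \<in> ?O" "t = case_prod (lamq n) y" by blast
  show ?thesis
  proof (rule ex1I[of _ y])
    show "y \<in> pairs_in n T \<inter> ?O" using y t O by (auto simp: pairs_in_def)
    fix z assume "z \<in> pairs_in n T \<inter> ?O"
    then have z: "z \<in> index_pairs n" "z \<in> ?O" "case_prod (lamq n) z \<in> T"
      by (auto simp: pairs_in_def)
    then have "case_prod (lamq n) z = t" by (intro unique) auto
    then show "z = y" using z(1) y O lamq_inj by (cases z; cases y) auto
  qed
qed

text \<open>On an orbit, a function extended by zero from the transversal is supported at the representative.\<close>

lemma transversal_orbit_sum:
  assumes T: "is_transversal n X T" and X: "X \<in> carrier (VBq n)" and x: "x \<in> pairs_in n T"
  shows "(\<Sum>z\<in>Orbits.orbit (on_pairs (pi_bar n X)) x. if z \<in> pairs_in n T then f z else (0::int)) = f x"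
proof -
  note p = pi_bar_permutes[OF X]
  let ?O = "Orbits.orbit (on_pairs (pi_bar n X)) x"
  have "x \<in> index_pairs n" using x by (auto simp: pairs_in_def)
  then have "?O \<inter> pairs_in n T = {x}"
    using transversal_representative[OF T X] x self_in_pair_orbit[OF p, of x] by blast
  moreover have "finite ?O" by (rule finite_orbit[OF self_in_pair_orbit[OF p]])
  ultimately show ?thesis by (simp add: sum.inter_restrict[symmetric])
qed

section \<open>Conjugacy and orbit sums\<close>

text \<open>Let \<open>x\<close> be the representative of its orbit.  As \<open>d = c\<inverse>\<close> commutes with \<open>\<pi>\<close>, it maps the orbit of \<open>x\<close>
bijectively onto that of \<open>d x\<close>, so the orbit sum of \<open>a' \<circ> (d \<times> d)\<close> at \<open>x\<close> is the exponent of \<open>a\<close> at the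
representative of the orbit of \<open>d x\<close>.  When the two orbits agree, this exponent is \<open>a x\<close>, which is how the first condition
becomes an instance of the second.\<close>

lemma orbit_sum_conditions_iff:
  fixes a b e :: "nat \<Rightarrow> nat \<Rightarrow> int"
  assumes X: "X \<in> carrier (VBq n)" and T: "is_transversal n X T"
    and c: "c \<in> centralizer (sym_ltr n) (theta_of n X)"
  defines "d \<equiv> inv\<^bsub>sym_ltr n\<^esub> c"
    and "a' \<equiv> \<lambda>x. if x \<in> pairs_in n T then case_prod a x else 0"
    and "b' \<equiv> \<lambda>x. if x \<in> pairs_in n T then case_prod b x else 0"
  shows "orbit_sum_conditions n (theta_of n X) T c e a b \<longleftrightarrow>
    (\<forall>x\<in>index_pairs n. (\<Sum>z\<in>Orbits.orbit (on_pairs (pi_bar n X)) x.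
      case_prod e z + a' (on_pairs d z) - b' z) = 0)"
proof -
  interpret S: group "sym_ltr n" by (rule group_sym_ltr)
  let ?\<pi> = "pi_bar n X"
  let ?O = "Orbits.orbit (on_pairs ?\<pi>)"
  note p = pi_bar_permutes[OF X]
  have cc: "c \<in> carrier (sym_ltr n)" and comm: "c \<otimes>\<^bsub>sym_ltr n\<^esub> theta_of n X = theta_of n X \<otimes>\<^bsub>sym_ltr n\<^esub> c"
    using c by (auto simp: centralizer_def)
  have \<theta>c: "theta_of n X \<in> carrier (sym_ltr n)"
    using theta_of_permutes[OF X] by (simp add: sym_ltr_simps)
  have d: "d permutes {1..n}" using S.inv_closed[OF cc] by (simp add: d_def sym_ltr_simps)
  have "d \<otimes>\<^bsub>sym_ltr n\<^esub> ?\<pi> = ?\<pi> \<otimes>\<^bsub>sym_ltr n\<^esub> d"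
    using arg_cong[OF comm, of "m_inv (sym_ltr n)"] cc \<theta>c
    by (simp add: S.inv_mult_group inv_theta_of[OF X] d_def)
  then have d_comm: "d (?\<pi> k) = ?\<pi> (d k)" for k
    by (simp add: sym_ltr_simps fun_eq_iff)
  have inj: "inj (on_pairs d)" using permutes_inj[OF d] by (simp add: prod.inj_map)
  have self: "x \<in> ?O x" for x by (rule self_in_pair_orbit[OF p])
  have fin: "finite (?O x)" for x by (rule finite_orbit[OF self])
  have d_orbit: "on_pairs d ` ?O x = ?O (on_pairs d x)" for x
    by (rule orbit_inverse[OF self]) (auto simp: d_comm)
  have shift: "(\<Sum>z\<in>?O x. a' (on_pairs d z)) = (\<Sum>z\<in>?O (on_pairs d x). a' z)" for x
    using sum.reindex[of "on_pairs d" "?O x" a'] inj_on_subset[OF inj]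
    by (simp add: d_orbit[symmetric])
  have R: "pairs_in n T \<subseteq> index_pairs n" by (auto simp: pairs_in_def)
  let ?E = "\<lambda>x. \<Sum>z\<in>?O x. case_prod e z"
  let ?A = "\<lambda>x. \<Sum>z\<in>?O (on_pairs d x). a' z"
  have \<theta>: "theta_of n X = inv\<^bsub>sym_ltr n\<^esub> ?\<pi>" by (simp add: theta_of_def)
  have same: "?A x = case_prod a x" if "x \<in> pairs_in n T" "on_pairs d x \<in> ?O x" for x
    unfolding pair_orbit_eq[OF p that(2)] a'_def by (rule transversal_orbit_sum[OF T X that(1)])
  have "orbit_sum_conditions n (theta_of n X) T c e a b \<longleftrightarrow>
      (\<forall>x\<in>pairs_in n T. (on_pairs d x \<in> ?O x \<longrightarrow> ?E x + case_prod a x = case_prod b x) \<and>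
        (on_pairs d x \<notin> ?O x \<longrightarrow> ?E x + ?A x = case_prod b x))"
  proof -
    have step: "(lamq n (d r) (d s) \<in> lam_orbit n (theta_of n X) r s \<longleftrightarrow> on_pairs d (r, s) \<in> ?O (r, s))
        \<and> (\<Sum>(i, j)\<in>pairs_in n (lam_orbit n (theta_of n X) r s). e i j) = ?E (r, s)
        \<and> (\<Sum>(i, j)\<in>pairs_in n (lam_orbit n (theta_of n X) (d r) (d s)).
              if lamq n i j \<in> T then a i j else 0) = ?A (r, s)"
      if "(r, s) \<in> pairs_in n T" for r s
    proof -
      have rs: "(r, s) \<in> index_pairs n" "(d r, d s) \<in> index_pairs n"
        using that R index_pairs_permutes[OF d] by auto
      have "(\<Sum>(i, j)\<in>?O (d r, d s). if lamq n i j \<in> T then a i j else 0) = ?A (r, s)"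
        using pair_orbit_subset_index_pairs[OF p rs(2)]
        by (intro sum.cong) (auto simp: a'_def pairs_in_def split: if_splits)
      then show ?thesis
        using rs by (simp add: \<theta> lamq_in_lam_orbit_iff[OF p] pairs_in_lam_orbit[OF p])
    qed
    show ?thesis
      unfolding orbit_sum_conditions_def Let_def d_def[symmetric]
      using step by (fastforce simp: split_paired_all)
  qed
  also have "\<dots> \<longleftrightarrow> (\<forall>x\<in>pairs_in n T. ?E x + ?A x = case_prod b x)"
    using same by fastforce
  also have "\<dots> \<longleftrightarrow> (\<forall>x\<in>pairs_in n T. (\<Sum>z\<in>?O x. case_prod e z + a' (on_pairs d z) - b' z) = 0)"
    using transversal_orbit_sum[OF T X, of _ "case_prod b"]
    by (simp add: sum_subtractf sum.distrib shift b'_def)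
  also have "\<dots> \<longleftrightarrow> (\<forall>x\<in>index_pairs n. (\<Sum>z\<in>?O x. case_prod e z + a' (on_pairs d z) - b' z) = 0)"
  proof (intro iffI ballI)
    fix x assume sums: "\<forall>x\<in>pairs_in n T. (\<Sum>z\<in>?O x. case_prod e z + a' (on_pairs d z) - b' z) = 0"
      and x: "x \<in> index_pairs n"
    obtain y where "y \<in> pairs_in n T" "y \<in> ?O x" using transversal_representative[OF T X x] by blast
    then show "(\<Sum>z\<in>?O x. case_prod e z + a' (on_pairs d z) - b' z) = 0"
      using sums pair_orbit_eq[OF p] by metis
  qed (use R in blast)
  finally show ?thesis .
qed

lemma conj_by_Lam_mult:
  assumes g: "g \<in> carrier (VBq n)" and X: "X \<in> carrier (VBq n)"
  shows "conj_by (VBq n) g (Lam n f \<otimes>\<^bsub>VBq n\<^esub> X)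
    = Lam n (\<lambda>x. f (on_pairs (pi_bar n g) x)) \<otimes>\<^bsub>VBq n\<^esub> conj_by (VBq n) g X"
  using group.conj_by_mult[OF group_VBq g Lam_in_VBq X] by (simp add: conj_by_Lam[OF g])

text \<open>A conjugating element is a lift whose exponents are determined by those of the two conjugate
elements.\<close>

lemma lift_exponents_of_conjugator:
  assumes g: "g \<in> carrier (VBq n)" and X: "X \<in> carrier (VBq n)"
    and eq: "conj_by (VBq n) g (Lam n f \<otimes>\<^bsub>VBq n\<^esub> X) = Lam n h \<otimes>\<^bsub>VBq n\<^esub> X"
  shows "conj_by (VBq n) g X = Lam n (\<lambda>x. h x - f (on_pairs (pi_bar n g) x)) \<otimes>\<^bsub>VBq n\<^esub> X"
proof -
  interpret group "VBq n" by (rule group_VBq)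
  let ?f = "\<lambda>x. f (on_pairs (pi_bar n g) x)"
  have "Lam n ?f \<otimes>\<^bsub>VBq n\<^esub> conj_by (VBq n) g X = Lam n h \<otimes>\<^bsub>VBq n\<^esub> X"
    using eq conj_by_Lam_mult[OF g X] by simp
  also have "\<dots> = Lam n ?f \<otimes>\<^bsub>VBq n\<^esub> (Lam n (\<lambda>x. h x - ?f x) \<otimes>\<^bsub>VBq n\<^esub> X)"
    using X by (simp add: m_assoc[symmetric] Lam_in_VBq Lam_mult)
  finally show ?thesis
    using g X by (simp add: Lam_in_VBq conj_by_closed)
qed

text \<open>Put \<open>u = h g\<inverse>\<close>, which has trivial permutation and thus an image \<open>(x, id)\<close> in the model.  Comparing
exponents in the image of \<open>u \<Lambda>(e) X = \<Lambda>(e') X u\<close>, in which those of \<open>X\<close> cancel, gives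
\<open>x + e = e' + x \<circ> (\<pi> \<times> \<pi>)\<close> with \<open>\<pi>\<close> the permutation of \<open>X\<close>.\<close>

lemma lift_exponents_cohomologous:
  assumes X: "X \<in> carrier (VBq n)" and g: "g \<in> carrier (VBq n)" "h \<in> carrier (VBq n)"
    and same: "pi_bar n g = pi_bar n h"
    and lifts: "conj_by (VBq n) g X = Lam n e \<otimes>\<^bsub>VBq n\<^esub> X" "conj_by (VBq n) h X = Lam n e' \<otimes>\<^bsub>VBq n\<^esub> X"
  obtains x where "\<And>k. k \<in> index_pairs n \<Longrightarrow> e' k - e k = x k - x (on_pairs (pi_bar n X) k)"
proof -
  interpret group "VBq n" by (rule group_VBq)
  interpret m: group_hom "VBq n" "model n" "vbq_model n" by (rule group_hom_vbq_model)
  interpret p: group_hom "VBq n" "sym_ltr n" "pi_bar n" by (rule group_hom_pi_bar)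
  let ?u = "h \<otimes>\<^bsub>VBq n\<^esub> inv\<^bsub>VBq n\<^esub> g"
  have u: "?u \<in> carrier (VBq n)" using g by simp
  have "pi_bar n ?u = \<one>\<^bsub>sym_ltr n\<^esub>" using g same p.hom_closed[OF g(2)] by simp
  then obtain x where x: "vbq_model n ?u = (x, id)"
    using snd_vbq_model[OF u] by (cases "vbq_model n ?u") (simp add: sym_ltr_simps)
  obtain s where s: "vbq_model n X = (s, pi_bar n X)"
    using snd_vbq_model[OF X] by (cases "vbq_model n X") simp
  have "conj_by (VBq n) ?u (Lam n e \<otimes>\<^bsub>VBq n\<^esub> X) = Lam n e' \<otimes>\<^bsub>VBq n\<^esub> X"
    using g X unfolding lifts[symmetric] by (simp add: conj_by_conj_by m_assoc)
  then have "?u \<otimes>\<^bsub>VBq n\<^esub> (Lam n e \<otimes>\<^bsub>VBq n\<^esub> X) = (Lam n e' \<otimes>\<^bsub>VBq n\<^esub> X) \<otimes>\<^bsub>VBq n\<^esub> ?u"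
    using u X by (subst (asm) conj_by_eq_iff) (simp_all add: Lam_in_VBq)
  then have "vbq_model n (?u \<otimes>\<^bsub>VBq n\<^esub> (Lam n e \<otimes>\<^bsub>VBq n\<^esub> X))
      = vbq_model n ((Lam n e' \<otimes>\<^bsub>VBq n\<^esub> X) \<otimes>\<^bsub>VBq n\<^esub> ?u)" by (rule arg_cong)
  then have "vbq_model n ?u \<otimes>\<^bsub>model n\<^esub> (vbq_model n (Lam n e) \<otimes>\<^bsub>model n\<^esub> vbq_model n X)
      = (vbq_model n (Lam n e') \<otimes>\<^bsub>model n\<^esub> vbq_model n X) \<otimes>\<^bsub>model n\<^esub> vbq_model n ?u"
    using u X by (simp only: m.hom_mult Lam_in_VBq m_closed)
  then have "(\<lambda>k. x k + ((if k \<in> index_pairs n then e k else 0) + s k))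
      = (\<lambda>k. (if k \<in> index_pairs n then e' k else 0) + s k + x (on_pairs (pi_bar n X) k))"
    unfolding x s vbq_model_Lam by (simp add: model_simps map_prod.id cong: if_cong)
  then have "e' k - e k = x k - x (on_pairs (pi_bar n X) k)" if "k \<in> index_pairs n" for k
    using fun_cong[of _ _ k] that by fastforce
  then show thesis by (rule that)
qed

theorem theorem3p9:
  fixes n :: nat and \<sigma> ct :: "vb_gen word set set" and \<theta> c :: "nat \<Rightarrow> nat"
    and T :: "vb_gen word set set set" and e a b :: "nat \<Rightarrow> nat \<Rightarrow> int"
  assumes "n \<ge> 2"
    and "\<sigma> \<in> carrier (VBq n)"
    and "\<theta> = theta_of n \<sigma>"
    and "is_transversal n \<sigma> T"
    and "centralizing_lift n \<sigma> c ct e"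
  shows "let A = lam_prod n (pairs_in n T) a \<otimes>\<^bsub>VBq n\<^esub> \<sigma>;
             B = lam_prod n (pairs_in n T) b \<otimes>\<^bsub>VBq n\<^esub> \<sigma>
         in ((\<exists>g \<in> carrier (VBq n). theta_of n g = c
                \<and> g \<otimes>\<^bsub>VBq n\<^esub> A \<otimes>\<^bsub>VBq n\<^esub> inv\<^bsub>VBq n\<^esub> g = B)
              \<longleftrightarrow> orbit_sum_conditions n \<theta> T c e a b)
          \<and> (conjugate_in (VBq n) A B
              \<longleftrightarrow> (\<exists>c' ct' e'. centralizing_lift n \<sigma> c' ct' e'
                     \<and> orbit_sum_conditions n \<theta> T c' e' a b))"
proof -
  interpret group "VBq n" by (rule group_VBq)
  interpret S: group "sym_ltr n" by (rule group_sym_ltr)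
  interpret p: group_hom "VBq n" "sym_ltr n" "pi_bar n" by (rule group_hom_pi_bar)
  note \<sigma> = assms(2) and \<theta> = assms(3) and T = assms(4)
  note perm = pi_bar_permutes[OF \<sigma>]
  have R: "pairs_in n T \<subseteq> index_pairs n" by (auto simp: pairs_in_def)
  define a' where "a' = (\<lambda>x. if x \<in> pairs_in n T then case_prod a x else 0)"
  define b' where "b' = (\<lambda>x. if x \<in> pairs_in n T then case_prod b x else 0)"
  define A where "A = Lam n a' \<otimes>\<^bsub>VBq n\<^esub> \<sigma>"
  define B where "B = Lam n b' \<otimes>\<^bsub>VBq n\<^esub> \<sigma>"
  let ?O = "Orbits.orbit (on_pairs (pi_bar n \<sigma>))"
  have self: "x \<in> ?O x" for x by (rule self_in_pair_orbit[OF perm])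
  have conditions: "orbit_sum_conditions n \<theta> T c e a b \<longleftrightarrow>
      (\<forall>x\<in>index_pairs n. (\<Sum>z\<in>?O x. case_prod e z + a' (on_pairs (pi_bar n g) z) - b' z) = 0)"
    if "c \<in> centralizer (sym_ltr n) \<theta>" "g \<in> carrier (VBq n)" "theta_of n g = c" for c g e
  proof -
    have "pi_bar n g = inv\<^bsub>sym_ltr n\<^esub> c" using inv_theta_of[OF that(2)] that(3) by simp
    then show ?thesis
      unfolding \<theta> a'_def b'_def by (simp only: orbit_sum_conditions_iff[OF \<sigma> T that(1)[unfolded \<theta>]])
  qed
  have lift: "conj_by (VBq n) g \<sigma> = Lam n (\<lambda>x. b' x - a' (on_pairs (pi_bar n g) x)) \<otimes>\<^bsub>VBq n\<^esub> \<sigma>"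
    if "g \<in> carrier (VBq n)" "conj_by (VBq n) g A = B" for g
    using lift_exponents_of_conjugator[OF that(1) \<sigma>] that(2) by (simp add: A_def B_def)
  have with_lift: "(\<exists>g \<in> carrier (VBq n). theta_of n g = c \<and> conj_by (VBq n) g A = B)
      \<longleftrightarrow> orbit_sum_conditions n \<theta> T c e a b"
    if "centralizing_lift n \<sigma> c ct e" for c ct e
  proof
    have c: "c \<in> centralizer (sym_ltr n) \<theta>" and ct: "ct \<in> carrier (VBq n)" "theta_of n ct = c"
      and ct_lift: "conj_by (VBq n) ct \<sigma> = Lam n (case_prod e) \<otimes>\<^bsub>VBq n\<^esub> \<sigma>"
      using that by (auto simp: centralizing_lift_def \<theta> conj_by_def)
    let ?D = "on_pairs (pi_bar n ct)"
    let ?P = "on_pairs (pi_bar n \<sigma>)"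
    {
      assume "\<exists>g \<in> carrier (VBq n). theta_of n g = c \<and> conj_by (VBq n) g A = B"
      then obtain g where g: "g \<in> carrier (VBq n)" "theta_of n g = c" "conj_by (VBq n) g A = B" by blast
      have same: "pi_bar n ct = pi_bar n g"
        using theta_of_eq_iff[OF ct(1) g(1)] ct g by simp
      obtain x where x: "\<And>k. k \<in> index_pairs n \<Longrightarrow>
          (b' k - a' (on_pairs (pi_bar n g) k)) - case_prod e k = x k - x (?P k)"
        using lift_exponents_cohomologous[OF \<sigma> ct(1) g(1) same ct_lift lift[OF g(1,3)]] by blast
      have "(\<Sum>z\<in>?O y. case_prod e z + a' (?D z) - b' z) = 0" if y: "y \<in> index_pairs n" for y
      proof -
        have "(\<Sum>z\<in>?O y. case_prod e z + a' (?D z) - b' z) = (\<Sum>z\<in>?O y. - (x z - x (?P z)))"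
          using x pair_orbit_subset_index_pairs[OF perm y] same by (intro sum.cong) force+
        then show ?thesis using coboundary_orbit_sum_zero[OF self[of y], of x] by (simp add: sum_subtractf)
      qed
      then show "orbit_sum_conditions n \<theta> T c e a b" using conditions[OF c ct] by blast
    next
      assume "orbit_sum_conditions n \<theta> T c e a b"
      then have sums: "(\<Sum>z\<in>?O y. b' z - a' (?D z) - case_prod e z) = 0" if "y \<in> index_pairs n" for y
        using conditions[OF c ct] that sum_negf[of "\<lambda>z. case_prod e z + a' (?D z) - b' z" "?O y"]
        by (simp add: algebra_simps)
      obtain x where x: "\<And>y. y \<in> ?O y \<Longrightarrow> (\<Sum>z\<in>?O y. b' z - a' (?D z) - case_prod e z) = 0 \<Longrightarrow>
          x y - x (?P y) = b' y - a' (?D y) - case_prod e y"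
        using coboundary_if_orbit_sums_zero[of ?P "\<lambda>z. b' z - a' (?D z) - case_prod e z"] by blast
      \<comment> \<open>Multiplying the given lift by \<open>\<Lambda>(x)\<close> corrects its exponents by the coboundary of \<open>x\<close>.\<close>
      let ?g = "Lam n x \<otimes>\<^bsub>VBq n\<^esub> ct"
      have g: "?g \<in> carrier (VBq n)" by (simp add: ct Lam_in_VBq)
      have "pi_bar n ?g = pi_bar n ct" by (simp add: pi_bar_mult ct Lam_in_VBq pi_bar_Lam)
      then have "theta_of n ?g = c" using theta_of_eq_iff[OF g ct(1)] ct by simp
      moreover have "conj_by (VBq n) ?g A = B"
      proof -
        let ?f = "\<lambda>k. a' (?D k) + case_prod e k"
        have \<sigma>x: "\<sigma> \<otimes>\<^bsub>VBq n\<^esub> inv\<^bsub>VBq n\<^esub> Lam n x = Lam n (\<lambda>k. - x (?P k)) \<otimes>\<^bsub>VBq n\<^esub> \<sigma>"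
          using conj_by_Lam[OF \<sigma>, of "\<lambda>k. - x k"] \<sigma> conj_by_eq_iff
          by (simp add: Lam_in_VBq Lam_inv)
        have "conj_by (VBq n) ct A = Lam n ?f \<otimes>\<^bsub>VBq n\<^esub> \<sigma>"
          unfolding A_def conj_by_Lam_mult[OF ct(1) \<sigma>] ct_lift
          using \<sigma> by (simp only: m_assoc[symmetric] Lam_in_VBq Lam_mult)
        moreover have "conj_by (VBq n) ?g A = conj_by (VBq n) (Lam n x) (conj_by (VBq n) ct A)"
          using ct \<sigma> by (simp add: A_def conj_by_conj_by Lam_in_VBq)
        ultimately have "conj_by (VBq n) ?g A
            = Lam n x \<otimes>\<^bsub>VBq n\<^esub> Lam n ?f \<otimes>\<^bsub>VBq n\<^esub> (\<sigma> \<otimes>\<^bsub>VBq n\<^esub> inv\<^bsub>VBq n\<^esub> Lam n x)"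
          using \<sigma> by (simp add: conj_by_def m_assoc Lam_in_VBq)
        also have "\<dots> = Lam n (\<lambda>k. x k + ?f k + - x (?P k)) \<otimes>\<^bsub>VBq n\<^esub> \<sigma>"
          unfolding \<sigma>x using \<sigma> by (simp only: m_assoc[symmetric] Lam_in_VBq Lam_mult m_closed)
        also have "\<dots> = B"
          unfolding B_def
        proof (rule arg_cong[where f = "\<lambda>L. L \<otimes>\<^bsub>VBq n\<^esub> \<sigma>"], rule Lam_cong)
          fix k assume k: "k \<in> index_pairs n"
          show "x k + ?f k + - x (?P k) = b' k" using x[OF self sums[OF k]] by linarith
        qed
        finally show ?thesis .
      qed
      ultimately show "\<exists>g \<in> carrier (VBq n). theta_of n g = c \<and> conj_by (VBq n) g A = B"
        using g by blast
    }
  qed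
  have "conjugate_in (VBq n) A B \<longleftrightarrow>
      (\<exists>c' ct' e'. centralizing_lift n \<sigma> c' ct' e' \<and> orbit_sum_conditions n \<theta> T c' e' a b)"
  proof
    assume "conjugate_in (VBq n) A B"
    then obtain g where g: "g \<in> carrier (VBq n)" "conj_by (VBq n) g A = B"
      by (auto simp: conjugate_in_def conj_by_def)
    \<comment> \<open>The conjugating element serves as the lift of its own permutation.\<close>
    define e' where "e' = curry (\<lambda>x. b' x - a' (on_pairs (pi_bar n g) x))"
    have g_lift: "conj_by (VBq n) g \<sigma> = lam_prod n (index_pairs n) e' \<otimes>\<^bsub>VBq n\<^esub> \<sigma>"
      unfolding e'_def by (rule lift[OF g])
    \<comment> \<open>Projecting \<open>g\<sigma>g\<inverse> = \<Lambda>(e')\<sigma>\<close> to \<open>S\<^sub>n\<close> shows that \<open>g\<close> lies over the centralizer of \<open>\<theta>\<close>.\<close>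
    have "pi_bar n (g \<otimes>\<^bsub>VBq n\<^esub> \<sigma>) = pi_bar n (lam_prod n (index_pairs n) e' \<otimes>\<^bsub>VBq n\<^esub> \<sigma> \<otimes>\<^bsub>VBq n\<^esub> g)"
      using g_lift g \<sigma> Lam_in_VBq[of n "case_prod e'"]
      by (subst (asm) conj_by_eq_iff) simp_all
    then have comm: "pi_bar n g \<otimes>\<^bsub>sym_ltr n\<^esub> pi_bar n \<sigma> = pi_bar n \<sigma> \<otimes>\<^bsub>sym_ltr n\<^esub> pi_bar n g"
      using g \<sigma> Lam_in_VBq[of n "case_prod e'"] pi_bar_Lam[of n "case_prod e'"]
      by (simp add: sym_ltr_simps)
    have "theta_of n g \<in> centralizer (sym_ltr n) \<theta>"
      using arg_cong[OF comm, of "m_inv (sym_ltr n)"] g \<sigma>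
      by (simp add: centralizer_def theta_of_def \<theta> S.inv_mult_group)
    moreover from this have "centralizing_lift n \<sigma> (theta_of n g) g e'"
      using g(1) g_lift by (simp add: centralizing_lift_def \<theta> conj_by_def)
    ultimately show "\<exists>c' ct' e'. centralizing_lift n \<sigma> c' ct' e' \<and> orbit_sum_conditions n \<theta> T c' e' a b"
      using with_lift g by blast
  next
    assume "\<exists>c' ct' e'. centralizing_lift n \<sigma> c' ct' e' \<and> orbit_sum_conditions n \<theta> T c' e' a b"
    then show "conjugate_in (VBq n) A B"
      using with_lift by (fastforce simp: conjugate_in_def conj_by_def)
  qed
  moreover have "lam_prod n (pairs_in n T) a = Lam n a'" "lam_prod n (pairs_in n T) b = Lam n b'"
    using lam_prod_eq_Lam[OF R] by (simp_all add: a'_def b'_def)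
  ultimately show ?thesis
    using with_lift[OF assms(5)] by (simp add: Let_def A_def B_def conj_by_def)
qed

end
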